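(* Fix $\rho>0$. For each $n\ge 3$ let $f=f_n$ be the $\sqrt{\frac{2\log n}{\log\log n}}$-threshold two-thinning strategy for the allocation of $\lfloor \rho n\rfloor$ balls into $n$ bins. Then $f$ is asymptotically optimal and, with high probability as $n\to\infty$, $$\mathrm{MaxLoad}^f_{\rho n}([n]) = (1+o(1))\sqrt{\frac{8\log n}{\log\log n}}.$$ That is, for every $\delta>0$, $\mathbb{P}\left((1-\delta)\sqrt{\frac{8\log n}{\log\log n}}\le \mathrm{MaxLoad}^f_{\rho n}([n])\le (1+\delta)\sqrt{\frac{8\log n}{\log\log n}}\right)\to 1$ as $n\to\infty$.
   Context: Here $[n]=\{1,\dots,n\}$ is the set of bins. Two-thinning: balls $t=1,2,\dots$ are allocated sequentially. Let $\{Z^0_t\}_{t\in\mathbb{N}_0}$ and $\{Z^1_t\}_{t\in\mathbb{N}_0}$ be two mutually independent sequences of independent random variables uniform on $[n]$. $Z^0_t$ is the primary allocation of ball $t$, and $\{Z^1_t\}$ is a pool of secondary allocations. A two-thinning strategy is a function which, for each ball $t$, decides whether to accept or reject $Z^0_t$, depending only on the history of the process up to time $t-1$ and on $Z^0_t$. Let $r_t$ be the number of rejections among the first $t-1$ primary allocations. If $Z^0_t$ is accepted, ball $t$ is placed in bin $Z_t=Z^0_t$; if it is rejected, ball $t$ is placed in bin $Z_t=Z^1_{r_t}$ (thus a new independent uniform bin, whose allocation cannot be rejected). For a strategy $f$, $\mathrm{MaxLoad}^f_t([n])=\max_{m\in[n]}|\{1\le i\le \lfloor t\rfloor: Z_i=m\}|$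 is the load of the most heavily loaded bin after $\lfloor t\rfloor$ balls have been allocated following $f$. Threshold strategy: for real $\ell>0$, the $\ell$-threshold strategy rejects a ball whenever the number of primary allocations to the suggested bin is at least $\ell$; precisely, ball $t$ is rejected if and only if $A_t(Z^0_t)\ge \ell$, where $A_t(m)=|\{1\le i\le t: Z^0_i=m\}|$ counts all primary allocations to $m$ up to and including time $t$ (accepted or not). Asymptotic optimality: $f=f_n$ is asymptotically optimal if for any strategy $g=g_n$, $\mathrm{MaxLoad}^f_{\rho n}([n])\le (1+o(1))\,\mathrm{MaxLoad}^g_{\rho n}([n])$ with high probability, i.e. for every $\delta>0$ and every sequence of strategies $g_n$, $\mathbb{P}\big(\mathrm{MaxLoad}^{f}_{\rho n}([n])\le(1+\delta)\mathrm{MaxLoad}^{g}_{\rho n}([n])\big)\to1$ as $n\to\infty$ (both processes being driven by the same sequences $Z^0,Z^1$). "With high probability" means with probability tending to $1$ as $n\to\infty$. *)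

theory Defs
  imports "HOL-Probability.Probability"
begin

text \<open>
  Bins are the numbers in \<open>{1..n}\<close>, balls are numbered \<open>1, 2, \<dots>\<close>. A history lists, oldest ball
  first, one triple per ball: its primary allocation, whether that was rejected, and the bin in
  which the ball was finally placed. A strategy maps the history before a ball and the ball's
  primary allocation to \<open>True\<close> iff the primary allocation is rejected; the time of the ball is the
  length of the history plus one.
\<close>

type_synonym history = "(nat \<times> bool \<times> nat) list"
type_synonym strategy = "history \<Rightarrow> nat \<Rightarrow> bool"

definition num_rejected :: "history \<Rightarrow> nat" where
  "num_rejected h = length (filter (\<lambda>(p, rej, b). rej) h)"

text \<open>Since \<open>num_rejected\<close> counts the earlier rejections only, the pool \<open>z1\<close> of secondary
  allocations is consumed starting at \<open>z1 0\<close>.\<close>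

definition place :: "strategy \<Rightarrow> (nat \<Rightarrow> nat) \<Rightarrow> history \<Rightarrow> nat \<Rightarrow> nat" where
  "place f z1 h x = (if f h x then z1 (num_rejected h) else x)"

primrec history_upto :: "strategy \<Rightarrow> (nat \<Rightarrow> nat) \<Rightarrow> (nat \<Rightarrow> nat) \<Rightarrow> nat \<Rightarrow> history" where
  "history_upto f z0 z1 0 = []"
| "history_upto f z0 z1 (Suc t) =
     (let h = history_upto f z0 z1 t; x = z0 (Suc t) in h @ [(x, f h x, place f z1 h x)])"

text \<open>The bin of ball \<open>t\<close>, for \<open>t \<ge> 1\<close>; the value \<open>z0 0\<close> is never used for a ball.\<close>

definition alloc :: "strategy \<Rightarrow> (nat \<Rightarrow> nat) \<Rightarrow> (nat \<Rightarrow> nat) \<Rightarrow> nat \<Rightarrow> nat" where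
  "alloc f z0 z1 t = place f z1 (history_upto f z0 z1 (t - 1)) (z0 t)"

definition max_load :: "nat \<Rightarrow> strategy \<Rightarrow> (nat \<Rightarrow> nat) \<Rightarrow> (nat \<Rightarrow> nat) \<Rightarrow> real \<Rightarrow> nat" where
  "max_load n f z0 z1 t = Max ((\<lambda>m. card {i \<in> {1..nat \<lfloor>t\<rfloor>}. alloc f z0 z1 i = m}) ` {1..n})"

text \<open>The counted list includes the current primary allocation \<open>x\<close> itself.\<close>

definition threshold_strategy :: "real \<Rightarrow> strategy" where
  "threshold_strategy l h x \<longleftrightarrow> real (count_list (map fst h @ [x]) x) \<ge> l"

text \<open>Joint independence of the family indexed by \<open>nat + nat\<close> says that the variables within each
  sequence are independent and that the two sequences are independent of each other.\<close>

locale two_thinning_source = prob_space M for M :: "'a measure" +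
  fixes n :: nat and Z0 Z1 :: "nat \<Rightarrow> 'a \<Rightarrow> nat"
  assumes indep: "indep_vars (\<lambda>_. count_space {1..n}) (case_sum Z0 Z1) UNIV"
    and uniform0: "\<And>t. distr M (count_space {1..n}) (Z0 t) = uniform_count_measure {1..n}"
    and uniform1: "\<And>t. distr M (count_space {1..n}) (Z1 t) = uniform_count_measure {1..n}"

definition MaxLoad ::
    "nat \<Rightarrow> strategy \<Rightarrow> (nat \<Rightarrow> 'a \<Rightarrow> nat) \<Rightarrow> (nat \<Rightarrow> 'a \<Rightarrow> nat) \<Rightarrow> real \<Rightarrow> 'a \<Rightarrow> real" where
  "MaxLoad n f Z0 Z1 t \<omega> = real (max_load n f (\<lambda>i. Z0 i \<omega>) (\<lambda>i. Z1 i \<omega>) t)"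

definition asymptotically_optimal ::
    "(nat \<Rightarrow> 'a measure) \<Rightarrow> (nat \<Rightarrow> nat \<Rightarrow> 'a \<Rightarrow> nat) \<Rightarrow> (nat \<Rightarrow> nat \<Rightarrow> 'a \<Rightarrow> nat) \<Rightarrow>
      real \<Rightarrow> (nat \<Rightarrow> strategy) \<Rightarrow> bool" where
  "asymptotically_optimal M Z0 Z1 \<rho> f \<longleftrightarrow>
     (\<forall>g :: nat \<Rightarrow> strategy. \<forall>\<delta>>0.
        (\<lambda>n. measure (M n) {\<omega> \<in> space (M n).
           MaxLoad n (f n) (Z0 n) (Z1 n) (\<rho> * real n) \<omega>
             \<le> (1 + \<delta>) * MaxLoad n (g n) (Z0 n) (Z1 n) (\<rho> * real n) \<omega>}) \<longlonglongrightarrow> 1)"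

end

theory Submission
  imports Defs "HOL-Real_Asymp.Real_Asymp"
begin

text \<open>
  Write \<open>l = sqrt (2 ln n / ln ln n)\<close> and \<open>r = ln n / l\<close> (below \<open>threshold n\<close> and \<open>rate n\<close>). The choice of
  \<open>l\<close> makes \<open>l ln l\<close> asymptotic to \<open>r\<close>, so for fixed \<open>a\<close> a bin that gets a Poisson number of balls with
  constant mean gets \<open>a l\<close> of them with probability about \<open>1 / (a l)! = exp (- (a + o(1)) r)\<close>. If only
  \<open>n exp (- b r)\<close> balls are thrown at the \<open>n\<close> bins, this probability becomes
  \<open>exp (- a b ln n - O(r))\<close>, because \<open>l r = ln n\<close>. As \<open>exp (O(r))\<close> is \<open>n\<close> to the power \<open>o(1)\<close>, one of
  \<open>n exp (- O(r))\<close> given bins then reaches \<open>a l\<close> if \<open>a b < 1\<close>, and no bin does if \<open>a b > 1\<close>.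

  Upper bound. The \<open>l\<close>-threshold strategy accepts at most \<open>l\<close> primary allocations per bin. By Markov's
  inequality it rejects at most \<open>n exp (- (1 - o(1)) r)\<close> balls, and as secondary allocations these
  raise the load of no bin by more than \<open>(1 + o(1)) l\<close>. Hence the maximal load is at most
  \<open>(2 + o(1)) l\<close> (\<open>prob_MaxLoad_threshold_ge_le\<close>, \<open>MaxLoad_threshold_le_asymp\<close>).

  Lower bound, for an arbitrary strategy. Fix a small \<open>e > 0\<close> and cut the balls into \<open>N\<close> phases of equal
  length, where \<open>N\<close> is about \<open>2 / e\<close>. The invariant is that at the start of phase \<open>j\<close> at least
  \<open>n exp (- j e r)\<close> bins have load at least \<open>(j - 1) e l\<close>. In phase \<open>j\<close> more than
  \<open>2 n exp (- (j + 1) e r)\<close> bins receive \<open>j e l\<close> primary allocations. If the strategy rejects fewer than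
  \<open>n exp (- (j + 1) e r)\<close> balls in the phase, then half of these bins keep all of them, and
  the invariant holds at the next phase. Otherwise at least that many secondary balls
  are thrown, and one of the bins that had load \<open>(j - 1) e l\<close> receives about \<open>l / ((j + 1) e)\<close> of them. With
  \<open>x = (j + 1) e\<close> its load becomes \<open>(x + 1 / x - O(e)) l\<close>, which is at least \<open>(2 - O(e)) l\<close>. If the second
  case never occurs, the final invariant gives a bin of load \<open>(N - 1) e l\<close>, which is at least
  \<open>(2 - e) l\<close>. The deterministic step is \<open>heavy_bins_step\<close>; the two random inputs come from
  Chebyshev's inequality (\<open>prob_few_bins_with_hits_le\<close>), for the secondary balls after conditioning on the
  history at the start of the phase (\<open>prob_no_bin_in_random_set_hit_le\<close>). They are combined in
  \<open>prob_MaxLoad_less_le\<close> and \<open>MaxLoad_ge_asymp\<close>.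

  Since \<open>sqrt (8 ln n / ln ln n) = 2 l\<close>, the upper bound for the threshold strategy and the lower bound for
  every strategy give both claims.
\<close>

section \<open>Finitely many independent uniform allocations\<close>

text \<open>
  The process is a deterministic function of a sample \<open>x\<close> of all allocations. That a property of \<open>x\<close>
  looks only at the allocations with index in \<open>A\<close> gives measurability if \<open>A\<close> is finite, and
  independence of properties that look at disjoint index sets.
\<close>

definition determined_by :: "(('i \<Rightarrow> 'b) \<Rightarrow> bool) \<Rightarrow> 'i set \<Rightarrow> bool" where
  "determined_by P A \<longleftrightarrow> (\<forall>x y. (\<forall>i\<in>A. x i = y i) \<longrightarrow> P x = P y)"

lemma determined_byI:
  "(\<And>x y. (\<And>i. i \<in> A \<Longrightarrow> x i = y i) \<Longrightarrow> P x = P y) \<Longrightarrow> determined_by P A"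
  unfolding determined_by_def by blast

lemma determined_byD:
  "determined_by P A \<Longrightarrow> (\<And>i. i \<in> A \<Longrightarrow> x i = y i) \<Longrightarrow> P x = P y"
  unfolding determined_by_def by blast



locale uniform_allocation = prob_space M for M :: "'a measure" +
  fixes n :: nat and X :: "'i \<Rightarrow> 'a \<Rightarrow> nat"
  assumes indep: "indep_vars (\<lambda>_. count_space {1..n}) X UNIV"
    and uniform: "\<And>i. distr M (count_space {1..n}) (X i) = uniform_count_measure {1..n}"
begin

definition event :: "(('i \<Rightarrow> nat) \<Rightarrow> bool) \<Rightarrow> 'a set" where
  "event P = {\<omega> \<in> space M. P (\<lambda>i. X i \<omega>)}"

lemma measurable_X [measurable]: "X i \<in> measurable M (count_space {1..n})"
  using indep by (auto simp: indep_vars_def)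

lemma X_range: "\<omega> \<in> space M \<Longrightarrow> X i \<omega> \<in> {1..n}"
  using measurable_space[OF measurable_X] by fastforce

lemma n_pos: "n > 0"
proof -
  obtain \<omega> where "\<omega> \<in> space M" using not_empty by blast
  from X_range[OF this, of undefined] show ?thesis by auto
qed

text \<open>
  All values lie in \<open>{1..n}\<close>, so a property that looks at a finite index set \<open>A\<close> is an event of
  the finite discrete space \<open>PiE A (\<lambda>_. {1..n})\<close>, in which every set is measurable.
\<close>

lemma finite_restrict_event:
  assumes "finite A" "determined_by P A"
  shows "{x \<in> PiE A (\<lambda>_. {1..n}). P x} \<in> sets (PiM A (\<lambda>_. count_space {1..n}))" (is ?th1)
    and "event P = (\<lambda>\<omega>. restrict (\<lambda>i. X i \<omega>) A) -` {x \<in> PiE A (\<lambda>_. {1..n}). P x} \<inter> space M" (is ?th2)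
proof -
  show ?th1 using assms(1) by (auto simp: count_space_PiM_finite)
  have *: "P (\<lambda>i. X i \<omega>) = P (restrict (\<lambda>i. X i \<omega>) A)" for \<omega>
    by (rule determined_byD[OF assms(2)]) simp
  show ?th2
    using X_range by (auto simp: event_def * PiE_iff)
qed

lemma event_measurable:
  assumes "finite A" "determined_by P A"
  shows "event P \<in> events"
proof -
  have "(\<lambda>\<omega>. restrict (\<lambda>i. X i \<omega>) A) \<in> measurable M (PiM A (\<lambda>_. count_space {1..n}))"
    by (intro measurable_restrict measurable_X)
  from measurable_sets[OF this finite_restrict_event(1)[OF assms]] show ?thesis
    using finite_restrict_event(2)[OF assms] by simp
qed

lemma prob_event_indep:
  assumes "finite A" "determined_by P A" "finite B" "determined_by Q B" "A \<inter> B = {}"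
  shows "prob (event (\<lambda>x. P x \<and> Q x)) = prob (event P) * prob (event Q)"
proof -
  let ?A = "{x \<in> PiE A (\<lambda>_. {1..n}). P x}" and ?B = "{x \<in> PiE B (\<lambda>_. {1..n}). Q x}"
  let ?XA = "\<lambda>\<omega>. restrict (\<lambda>i. X i \<omega>) A" and ?XB = "\<lambda>\<omega>. restrict (\<lambda>i. X i \<omega>) B"
  have "event (\<lambda>x. P x \<and> Q x) = event P \<inter> event Q" by (auto simp: event_def)
  also have "\<dots> = (\<lambda>\<omega>. (?XA \<omega>, ?XB \<omega>)) -` (?A \<times> ?B) \<inter> space M"
    unfolding finite_restrict_event(2)[OF assms(1,2)] finite_restrict_event(2)[OF assms(3,4)]
    using X_range by (auto simp: PiE_iff simp del: One_nat_def)
  finally have "prob (event (\<lambda>x. P x \<and> Q x)) = prob ((\<lambda>\<omega>. (?XA \<omega>, ?XB \<omega>)) -` (?A \<times> ?B) \<inter> space M)"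
    by simp
  also have "\<dots> = prob (?XA -` ?A \<inter> space M) * prob (?XB -` ?B \<inter> space M)"
    by (rule indep_varD[OF indep_var_restrict[OF indep assms(5)]
          finite_restrict_event(1)[OF assms(1,2)] finite_restrict_event(1)[OF assms(3,4)]]) auto
  finally show ?thesis
    using finite_restrict_event(2)[OF assms(1,2)] finite_restrict_event(2)[OF assms(3,4)] by simp
qed

lemma prob_single: "S \<subseteq> {1..n} \<Longrightarrow> prob (X i -` S \<inter> space M) = card S / n"
proof -
  assume S: "S \<subseteq> {1..n}"
  have "prob (X i -` S \<inter> space M) = measure (distr M (count_space {1..n}) (X i)) S"
    using S by (subst measure_distr[OF measurable_X]) auto
  also have "\<dots> = card S / n"
    using S n_pos unfolding uniform measure_def
    by (subst emeasure_uniform_count_measure) auto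
  finally show ?thesis .
qed

lemma prob_box:
  assumes "finite W" "\<And>i. i \<in> W \<Longrightarrow> S i \<subseteq> {1..n}"
  shows "prob (event (\<lambda>x. \<forall>i\<in>W. x i \<in> S i)) = (\<Prod>i\<in>W. card (S i) / n)"
proof (cases "W = {}")
  case True
  then show ?thesis by (simp add: event_def prob_space)
next
  case False
  have "event (\<lambda>x. \<forall>i\<in>W. x i \<in> S i) = (\<Inter>i\<in>W. X i -` S i \<inter> space M)"
    using False by (auto simp: event_def)
  also have "prob \<dots> = (\<Prod>i\<in>W. prob (X i -` S i \<inter> space M))"
    using assms False by (intro indep_varsD[OF indep]) auto
  also have "\<dots> = (\<Prod>i\<in>W. card (S i) / n)"
    using assms(2) by (intro prod.cong prob_single) auto
  finally show ?thesis .
qed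

lemma event_mono: "(\<And>x. (\<And>i. x i \<in> {1..n}) \<Longrightarrow> P x \<Longrightarrow> Q x) \<Longrightarrow> event P \<subseteq> event Q"
  using X_range by (auto simp: event_def)

lemma prob_event_mono:
  assumes "finite A" "determined_by Q A" "\<And>x. (\<And>i. x i \<in> {1..n}) \<Longrightarrow> P x \<Longrightarrow> Q x"
  shows "prob (event P) \<le> prob (event Q)"
  by (intro finite_measure_mono event_mono event_measurable[OF assms(1,2)] assms(3))

lemma prob_event_union_bound:
  assumes "finite K" "finite A" "\<And>k. k \<in> K \<Longrightarrow> determined_by (Q k) A"
    and "\<And>x. (\<And>i. x i \<in> {1..n}) \<Longrightarrow> P x \<Longrightarrow> \<exists>k\<in>K. Q k x"
  shows "prob (event P) \<le> (\<Sum>k\<in>K. prob (event (Q k)))"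
proof -
  have "event P \<subseteq> (\<Union>k\<in>K. event (Q k))"
    using assms(4) X_range by (fastforce simp: event_def)
  then have "prob (event P) \<le> prob (\<Union>k\<in>K. event (Q k))"
    using assms(1-3) by (intro finite_measure_mono sets.finite_UN event_measurable) auto
  also have "\<dots> \<le> (\<Sum>k\<in>K. prob (event (Q k)))"
    using assms(1-3) by (intro finite_measure_subadditive_finite) (auto intro!: event_measurable)
  finally show ?thesis .
qed

end

context prob_space
begin

text \<open>Markov's inequality for the number of events that occur.\<close>

lemma prob_count_ge_le:
  assumes "finite I" "\<And>i. i \<in> I \<Longrightarrow> E i \<in> events" "v > 0"
  shows "prob {\<omega> \<in> space M. v \<le> real (card {i \<in> I. \<omega> \<in> E i})} \<le> (\<Sum>i\<in>I. prob (E i)) / v"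
proof -
  define S where "S \<omega> = (\<Sum>i\<in>I. indicat_real (E i) \<omega>)" for \<omega>
  have S: "S \<omega> = real (card {i \<in> I. \<omega> \<in> E i})" for \<omega>
    using assms(1) by (simp add: S_def indicator_def sum.If_cases Int_def)
  have int: "integrable M S"
    unfolding S_def using assms by (intro Bochner_Integration.integrable_sum) (auto simp: emeasure_eq_measure)
  have "prob {\<omega> \<in> space M. S \<omega> \<ge> v} \<le> expectation S / v"
    using assms(3) by (intro integral_Markov_inequality_measure[OF int, where A = "{}"]) (auto simp: S)
  also have "expectation S = (\<Sum>i\<in>I. prob (E i))"
    unfolding S_def using assms by (subst Bochner_Integration.integral_sum) (auto simp: emeasure_eq_measure)
  finally show ?thesis by (simp add: S)
qed

text \<open>
  Chebyshev's inequality for the number of events that occur. The factor \<open>c\<close> measures the pairwise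
  correlation: the variance is at most \<open>\<mu> + (c - 1) \<mu>\<^sup>2\<close> where \<open>\<mu>\<close> is the mean, so the
  bound is small if \<open>\<mu>\<close> is large and \<open>c\<close> is close to \<open>1\<close>.
\<close>

lemma prob_count_less_half_mean:
  fixes p c :: real
  assumes fin: "finite I" and E: "\<And>i. i \<in> I \<Longrightarrow> E i \<in> events" "\<And>i. i \<in> I \<Longrightarrow> prob (E i) = p"
    and pair: "\<And>i j. i \<in> I \<Longrightarrow> j \<in> I \<Longrightarrow> i \<noteq> j \<Longrightarrow> prob (E i \<inter> E j) \<le> c * p\<^sup>2"
    and pos: "p > 0" "I \<noteq> {}" "c \<ge> 0"
  shows "prob {\<omega> \<in> space M. real (card {i \<in> I. \<omega> \<in> E i}) < card I * p / 2}
           \<le> 4 / (card I * p) + 4 * (c - 1)"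
proof -
  define S where "S \<omega> = (\<Sum>i\<in>I. indicat_real (E i) \<omega>)" for \<omega>
  have S: "S \<omega> = real (card {i \<in> I. \<omega> \<in> E i})" for \<omega>
    using fin by (simp add: S_def indicator_def sum.If_cases Int_def)
  define \<mu> where "\<mu> = card I * p"
  have card: "card I > 0" using fin pos by (simp add: card_gt_0_iff)
  have \<mu>: "\<mu> > 0" using card pos by (simp add: \<mu>_def)
  have [measurable]: "random_variable borel S"
    unfolding S_def using E by (intro borel_measurable_sum) auto
  have S2: "(S \<omega>)\<^sup>2 = (\<Sum>i\<in>I. \<Sum>j\<in>I. indicat_real (E i \<inter> E j) \<omega>)" for \<omega>
    unfolding S_def power2_eq_square sum_product by (simp add: indicator_inter_arith)
  have intS: "integrable M S"
    unfolding S_def using E by (intro Bochner_Integration.integrable_sum) (auto simp: emeasure_eq_measure)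
  have intS2: "integrable M (\<lambda>\<omega>. (S \<omega>)\<^sup>2)"
    unfolding S2 using E
    by (intro Bochner_Integration.integrable_sum) (auto simp: emeasure_eq_measure)
  have ES: "expectation S = \<mu>"
    unfolding S_def using E by (subst Bochner_Integration.integral_sum) (auto simp: emeasure_eq_measure \<mu>_def)
  have int2: "integrable M (indicat_real (E i \<inter> E j))" if "i \<in> I" "j \<in> I" for i j
    using E that by (auto simp: emeasure_eq_measure)
  have "expectation (\<lambda>\<omega>. (S \<omega>)\<^sup>2) = (\<Sum>i\<in>I. expectation (\<lambda>\<omega>. \<Sum>j\<in>I. indicat_real (E i \<inter> E j) \<omega>))"
    unfolding S2 by (intro Bochner_Integration.integral_sum Bochner_Integration.integrable_sum int2)
  also have "\<dots> = (\<Sum>i\<in>I. \<Sum>j\<in>I. expectation (indicat_real (E i \<inter> E j)))"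
    by (intro sum.cong refl Bochner_Integration.integral_sum int2)
  also have "\<dots> = (\<Sum>i\<in>I. \<Sum>j\<in>I. prob (E i \<inter> E j))"
    using E by (intro sum.cong refl) auto
  also have "\<dots> \<le> (\<Sum>i\<in>I. \<Sum>j\<in>I. (if i = j then p else 0) + c * p\<^sup>2)"
    using E pair pos by (intro sum_mono) auto
  also have "\<dots> = \<mu> + c * \<mu>\<^sup>2"
    using fin by (simp add: sum.distrib \<mu>_def power2_eq_square algebra_simps)
  finally have ES2: "expectation (\<lambda>\<omega>. (S \<omega>)\<^sup>2) \<le> \<mu> + c * \<mu>\<^sup>2" .
  have var: "variance S \<le> \<mu> + (c - 1) * \<mu>\<^sup>2"
    using ES2 by (subst variance_eq[OF intS intS2]) (simp add: ES algebra_simps)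
  have "prob {\<omega> \<in> space M. S \<omega> < \<mu> / 2} \<le> prob {\<omega> \<in> space M. \<mu> / 2 \<le> \<bar>S \<omega> - expectation S\<bar>}"
    by (rule finite_measure_mono) (auto simp: ES abs_real_def)
  also have "\<dots> \<le> variance S / (\<mu> / 2)\<^sup>2"
    using \<mu> intS2 by (intro Chebyshev_inequality) auto
  also have "\<dots> \<le> (\<mu> + (c - 1) * \<mu>\<^sup>2) / (\<mu> / 2)\<^sup>2"
    using var by (intro divide_right_mono) auto
  also have "\<dots> = 4 / \<mu> + 4 * (c - 1)"
    using \<mu> by (simp add: field_simps power2_eq_square)
  finally show ?thesis by (simp add: S \<mu>_def)
qed

end

section \<open>Occupancy of bins by a fixed set of balls\<close>

definition hits :: "('i \<Rightarrow> nat) \<Rightarrow> 'i set \<Rightarrow> nat \<Rightarrow> nat" where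
  "hits x W m = card {i \<in> W. x i = m}"

lemma hits_cong: "(\<And>i. i \<in> W \<Longrightarrow> x i = y i) \<Longrightarrow> hits x W m = hits y W m"
  unfolding hits_def by (intro arg_cong[where f = card]) auto

lemma determined_by_hits: "determined_by (\<lambda>x. Q (hits x W)) W"
proof (rule determined_byI)
  fix x y :: "'a \<Rightarrow> nat"
  assume "\<And>i. i \<in> W \<Longrightarrow> x i = y i"
  then have "hits x W = hits y W" by (intro ext hits_cong)
  then show "Q (hits x W) = Q (hits y W)" by (rule arg_cong)
qed

context uniform_allocation
begin

text \<open>Union bound over the \<open>s\<close>-element sets of balls that may all have hit \<open>m\<close>.\<close>

lemma prob_hits_ge_le:
  assumes W: "finite W" and m: "m \<in> {1..n}"
  shows "prob (event (\<lambda>x. s \<le> hits x W m)) \<le> real (card W choose s) / real n ^ s"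
proof -
  let ?F = "{K. K \<subseteq> W \<and> card K = s}"
  have fin: "finite ?F" using W by simp
  have "prob (event (\<lambda>x. s \<le> hits x W m)) \<le> (\<Sum>K\<in>?F. prob (event (\<lambda>x. \<forall>i\<in>K. x i \<in> {m})))"
  proof (rule prob_event_union_bound[OF fin W])
    show "determined_by (\<lambda>x. \<forall>i\<in>K. x i \<in> {m}) W" if "K \<in> ?F" for K
      using that by (auto intro!: determined_byI ball_cong)
    fix x :: "'i \<Rightarrow> nat"
    assume "s \<le> hits x W m"
    then obtain K where "K \<subseteq> {i \<in> W. x i = m}" "card K = s"
      unfolding hits_def by (metis obtain_subset_with_card_n)
    then show "\<exists>K\<in>?F. \<forall>i\<in>K. x i \<in> {m}" by (intro bexI[of _ K]) auto
  qed
  also have "\<dots> = (\<Sum>K\<in>?F. 1 / real n ^ s)"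
  proof (rule sum.cong[OF refl])
    fix K assume K: "K \<in> ?F"
    then have "finite K" using W finite_subset by blast
    then have "prob (event (\<lambda>x. \<forall>i\<in>K. x i \<in> {m})) = (\<Prod>i\<in>K. card {m} / n)"
      using m by (intro prob_box) auto
    also have "\<dots> = 1 / real n ^ s" using K by (simp add: power_divide)
    finally show "prob (event (\<lambda>x. \<forall>i\<in>K. x i \<in> {m})) = 1 / real n ^ s" .
  qed
  also have "\<dots> = real (card W choose s) / real n ^ s"
    by (simp add: n_subsets[OF W])
  finally show ?thesis .
qed

lemma prob_hits_eq:
  assumes W: "finite W" and m: "m \<in> {1..n}"
  shows "prob (event (\<lambda>x. hits x W m = k))
           = real (card W choose k) * (1 / n) ^ k * (1 - 1 / n) ^ (card W - k)"
proof -
  let ?F = "{K. K \<subseteq> W \<and> card K = k}"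
  let ?S = "\<lambda>K i. if i \<in> K then {m} else {1..n} - {m}"
  let ?E = "\<lambda>K. event (\<lambda>x. \<forall>i\<in>W. x i \<in> ?S K i)"
  have fin: "finite ?F" using W by simp
  have meas: "?E K \<in> events" for K
    using W by (intro event_measurable[of W] determined_byI) auto
  have sets: "{i \<in> W. X i \<omega> = m} = K" if "K \<subseteq> W" "\<omega> \<in> ?E K" for K \<omega>
  proof -
    have "X i \<omega> \<in> ?S K i" if "i \<in> W" for i
      using \<open>\<omega> \<in> ?E K\<close> that unfolding event_def by blast
    then have "X i \<omega> = m \<longleftrightarrow> i \<in> K" if "i \<in> W" for i using that by (meson Diff_iff singletonD singletonI)
    then show ?thesis using \<open>K \<subseteq> W\<close> by blast
  qed
  have "event (\<lambda>x. hits x W m = k) = (\<Union>K\<in>?F. ?E K)"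
  proof (intro equalityI subsetI)
    fix \<omega> assume \<omega>: "\<omega> \<in> event (\<lambda>x. hits x W m = k)"
    let ?K = "{i \<in> W. X i \<omega> = m}"
    have "?K \<in> ?F" using \<omega> by (auto simp: event_def hits_def)
    moreover have "\<omega> \<in> ?E ?K"
      using \<omega> X_range[of \<omega>] by (auto simp: event_def simp del: One_nat_def)
    ultimately show "\<omega> \<in> (\<Union>K\<in>?F. ?E K)" by blast
  next
    fix \<omega> assume "\<omega> \<in> (\<Union>K\<in>?F. ?E K)"
    then obtain K where K: "K \<subseteq> W" "card K = k" "\<omega> \<in> ?E K" by blast
    then have "hits (\<lambda>i. X i \<omega>) W m = k" using sets[OF K(1,3)] by (simp add: hits_def)
    then show "\<omega> \<in> event (\<lambda>x. hits x W m = k)" using K(3) by (simp add: event_def)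
  qed
  also have "prob \<dots> = (\<Sum>K\<in>?F. prob (?E K))"
  proof (rule finite_measure_finite_Union[OF fin])
    show "?E ` ?F \<subseteq> events" using meas by blast
    show "disjoint_family_on ?E ?F"
      unfolding disjoint_family_on_def using sets by blast
  qed
  also have "\<dots> = (\<Sum>K\<in>?F. (1 / n) ^ k * (1 - 1 / n) ^ (card W - k))"
  proof (rule sum.cong[OF refl])
    fix K assume K: "K \<in> ?F"
    have "prob (?E K) = (\<Prod>i\<in>W. card (?S K i) / n)"
      using W m by (intro prob_box) auto
    also have "\<dots> = (\<Prod>i\<in>W. if i \<in> K then 1 / n else 1 - 1 / n)"
      using m n_pos by (intro prod.cong) (auto simp: field_simps of_nat_diff)
    also have "\<dots> = (1 / n) ^ card (W \<inter> K) * (1 - 1 / n) ^ card (W - K)"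
      using W by (subst prod.If_cases) (simp_all add: Diff_eq Collect_neg_eq)
    also have "\<dots> = (1 / n) ^ k * (1 - 1 / n) ^ (card W - k)"
      using K W by (auto simp: Int_absorb1 card_Diff_subset finite_subset)
    finally show "prob (?E K) = (1 / n) ^ k * (1 - 1 / n) ^ (card W - k)" .
  qed
  also have "\<dots> = real (card W choose k) * (1 / n) ^ k * (1 - 1 / n) ^ (card W - k)"
    by (simp add: n_subsets[OF W])
  finally show ?thesis .
qed

text \<open>
  Two bins are almost uncorrelated: the sum over the pairs of disjoint \<open>k\<close>-sets of balls has at most
  \<open>(card W choose k)\<^sup>2\<close> terms, and a ball in neither set misses both bins with probability
  \<open>1 - 2 / n\<close>, which is at most \<open>(1 - 1 / n)\<^sup>2\<close>. The factor \<open>1 / (1 - 1 / n) ^ (2 * k)\<close>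
  remains because in the square of the one-bin probability \<open>2 * (card W - k)\<close> misses are counted,
  against \<open>card W - 2 * k\<close> double misses here.
\<close>

lemma prob_hits_eq_pair_le:
  assumes W: "finite W" and m: "m \<in> {1..n}" "m' \<in> {1..n}" "m \<noteq> m'" and n2: "n \<ge> 2"
  shows "prob (event (\<lambda>x. hits x W m = k \<and> hits x W m' = k))
           \<le> (1 / (1 - 1 / n) ^ (2 * k)) * (prob (event (\<lambda>x. hits x W m = k)))\<^sup>2"
proof -
  let ?w = "card W" and ?a = "1 - 1 / real n"
  let ?F = "SIGMA K:{K. K \<subseteq> W \<and> card K = k}. {K'. K' \<subseteq> W - K \<and> card K' = k}"
  let ?S = "\<lambda>(K, K') i. if i \<in> K then {m} else if i \<in> K' then {m'} else {1..n} - {m, m'}"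
  let ?E = "\<lambda>K. event (\<lambda>x. \<forall>i\<in>W. x i \<in> ?S K i)"
  have fin: "finite ?F" using W by auto
  have a: "?a > 0" using n2 by simp
  have cardF: "card ?F = (?w choose k) * ((?w - k) choose k)"
  proof -
    have "card {K'. K' \<subseteq> W - K \<and> card K' = k} = ((?w - k) choose k)" if "K \<subseteq> W" "card K = k" for K
      using that W by (subst n_subsets) (auto simp: card_Diff_subset finite_subset)
    then show ?thesis using W by (subst card_SigmaI) (simp_all add: n_subsets)
  qed
  have box: "prob (?E K) \<le> (1 / n) ^ (2 * k) * ?a ^ (2 * (?w - 2 * k)) \<and> 2 * k \<le> ?w" if K: "K \<in> ?F" for K
  proof -
    obtain K1 K2 where K': "K = (K1, K2)" "K1 \<subseteq> W" "K2 \<subseteq> W" "K1 \<inter> K2 = {}" "card K1 = k" "card K2 = k"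
      using K by auto
    have finK: "finite K1" "finite K2" using K' W finite_subset by blast+
    have cU: "card (K1 \<union> K2) = 2 * k" using K' finK by (simp add: card_Un_disjoint)
    have le: "2 * k \<le> ?w" using card_mono[OF W, of "K1 \<union> K2"] K' cU by simp
    have "prob (?E K) = (\<Prod>i\<in>W. card (?S K i) / n)"
      using W m by (intro prob_box) (auto simp: K'(1))
    also have "\<dots> = (\<Prod>i\<in>W. if i \<in> K1 \<union> K2 then 1 / n else 1 - 2 / n)"
    proof (rule prod.cong[OF refl])
      fix i assume "i \<in> W"
      have "card ({1..n} - {m, m'}) = n - 2" using m by (subst card_Diff_subset) auto
      then show "card (?S K i) / n = (if i \<in> K1 \<union> K2 then 1 / n else 1 - 2 / n)"
        using n2 by (auto simp: K'(1) field_simps of_nat_diff)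
    qed
    also have "\<dots> = (1 / n) ^ card (W \<inter> (K1 \<union> K2)) * (1 - 2 / n) ^ card (W - (K1 \<union> K2))"
      using W by (subst prod.If_cases) (simp_all add: Diff_eq Collect_neg_eq Int_def)
    also have "\<dots> = (1 / n) ^ (2 * k) * (1 - 2 / n) ^ (?w - 2 * k)"
      using K' W cU finK by (simp add: Int_absorb1 card_Diff_subset)
    also have "\<dots> \<le> (1 / n) ^ (2 * k) * (?a\<^sup>2) ^ (?w - 2 * k)"
      using n2 by (intro mult_left_mono power_mono) (auto simp: power2_eq_square field_simps)
    finally show ?thesis using le by (simp add: power_mult)
  qed
  have "prob (event (\<lambda>x. hits x W m = k \<and> hits x W m' = k)) \<le> (\<Sum>K\<in>?F. prob (?E K))"
  proof (rule prob_event_union_bound[OF fin W])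
    show "determined_by (\<lambda>x. \<forall>i\<in>W. x i \<in> ?S K i) W" for K
      by (intro determined_byI) auto
    fix x :: "'i \<Rightarrow> nat"
    assume x: "\<And>i. x i \<in> {1..n}" and h: "hits x W m = k \<and> hits x W m' = k"
    show "\<exists>K\<in>?F. \<forall>i\<in>W. x i \<in> ?S K i"
      using h x m(3) unfolding hits_def
      by (intro bexI[of _ "({i \<in> W. x i = m}, {i \<in> W. x i = m'})"]) (auto simp del: One_nat_def)
  qed
  also have "\<dots> \<le> (\<Sum>K\<in>?F. (1 / n) ^ (2 * k) * (?a ^ (2 * (?w - k)) / ?a ^ (2 * k)))"
  proof (rule sum_mono)
    fix K assume K: "K \<in> ?F"
    have le: "2 * k \<le> ?w" using box[OF K] by simp
    have "?a ^ (2 * (?w - 2 * k)) = ?a ^ (2 * (?w - k) - 2 * k)" by (rule arg_cong[where f = "\<lambda>j. ?a ^ j"]) simp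
    also have "\<dots> = ?a ^ (2 * (?w - k)) / ?a ^ (2 * k)"
      using a le by (intro power_diff) auto
    finally show "prob (?E K) \<le> (1 / n) ^ (2 * k) * (?a ^ (2 * (?w - k)) / ?a ^ (2 * k))"
      using box[OF K] by simp
  qed
  also have "\<dots> = (?w choose k) * ((?w - k) choose k) * ((1 / n) ^ (2 * k) * (?a ^ (2 * (?w - k)) / ?a ^ (2 * k)))"
    by (simp add: cardF)
  also have "\<dots> \<le> (?w choose k) * (?w choose k) * ((1 / n) ^ (2 * k) * (?a ^ (2 * (?w - k)) / ?a ^ (2 * k)))"
    using a by (intro mult_right_mono) (auto intro!: mult_left_mono binomial_right_mono)
  also have "\<dots> = (1 / ?a ^ (2 * k)) * (prob (event (\<lambda>x. hits x W m = k)))\<^sup>2"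
    unfolding prob_hits_eq[OF W m(1)] power_mult by (simp add: power2_eq_square power_mult_distrib power_divide mult_ac)
  finally show ?thesis .
qed

lemma prob_few_bins_with_hits_le:
  fixes p :: real
  assumes W: "finite W" "k \<le> card W" and B: "B \<subseteq> {1..n}" "B \<noteq> {}" and n2: "n \<ge> 2"
    and p: "p = real (card W choose k) * (1 / n) ^ k * (1 - 1 / n) ^ (card W - k)"
  shows "prob (event (\<lambda>x. real (card {m \<in> B. hits x W m = k}) < card B * p / 2))
           \<le> 4 / (card B * p) + 4 * (1 / (1 - 1 / n) ^ (2 * k) - 1)"
proof -
  let ?E = "\<lambda>m. event (\<lambda>x. hits x W m = k)"
  have fin: "finite B" using B finite_subset by blast
  have meas: "?E m \<in> events" for m
    by (rule event_measurable[OF W(1)]) (rule determined_by_hits)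
  have prob: "prob (?E m) = p" if "m \<in> B" for m
    unfolding p using that B(1) by (intro prob_hits_eq[OF W(1)] subsetD[OF B(1)])
  have pair: "prob (?E m \<inter> ?E m') \<le> (1 / (1 - 1 / n) ^ (2 * k)) * p\<^sup>2"
    if "m \<in> B" "m' \<in> B" "m \<noteq> m'" for m m'
  proof -
    have "?E m \<inter> ?E m' = event (\<lambda>x. hits x W m = k \<and> hits x W m' = k)"
      by (auto simp: event_def)
    then show ?thesis
      using prob_hits_eq_pair_le[OF W(1) subsetD[OF B(1) that(1)] subsetD[OF B(1) that(2)] that(3) n2, of k]
        prob[OF that(1)] by simp
  qed
  have "p > 0" using n2 W(2) by (simp add: p zero_less_binomial)
  have "event (\<lambda>x. real (card {m \<in> B. hits x W m = k}) < card B * p / 2)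
      = {\<omega> \<in> space M. real (card {m \<in> B. \<omega> \<in> ?E m}) < card B * p / 2}"
    unfolding event_def by (intro Collect_cong conj_cong refl) simp
  then show ?thesis
    using prob_count_less_half_mean[OF fin meas prob pair \<open>p > 0\<close> B(2)] n2 by simp
qed

end

section \<open>Dynamics of a two-thinning strategy\<close>

definition rejects :: "strategy \<Rightarrow> (nat \<Rightarrow> nat) \<Rightarrow> (nat \<Rightarrow> nat) \<Rightarrow> nat \<Rightarrow> bool" where
  "rejects f z0 z1 t \<longleftrightarrow> f (history_upto f z0 z1 (t - 1)) (z0 t)"

definition rejections :: "strategy \<Rightarrow> (nat \<Rightarrow> nat) \<Rightarrow> (nat \<Rightarrow> nat) \<Rightarrow> nat \<Rightarrow> nat" where
  "rejections f z0 z1 t = num_rejected (history_upto f z0 z1 t)"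

definition load :: "strategy \<Rightarrow> (nat \<Rightarrow> nat) \<Rightarrow> (nat \<Rightarrow> nat) \<Rightarrow> nat \<Rightarrow> nat \<Rightarrow> nat" where
  "load f z0 z1 t m = card {i \<in> {1..t}. alloc f z0 z1 i = m}"

definition accepted :: "strategy \<Rightarrow> (nat \<Rightarrow> nat) \<Rightarrow> (nat \<Rightarrow> nat) \<Rightarrow> nat \<Rightarrow> nat \<Rightarrow> nat" where
  "accepted f z0 z1 t m = card {i \<in> {1..t}. \<not> rejects f z0 z1 i \<and> z0 i = m}"

lemma max_load_eq: "max_load n f z0 z1 t = Max (load f z0 z1 (nat \<lfloor>t\<rfloor>) ` {1..n})"
  by (simp add: max_load_def load_def)

lemma card_filter_Suc:
  "card {i \<in> {1..Suc t}. P i} = card {i \<in> {1..t}. P i} + (if P (Suc t) then 1 else 0)"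
proof -
  have "{i \<in> {1..Suc t}. P i} = {i \<in> {1..t}. P i} \<union> (if P (Suc t) then {Suc t} else {})"
    by (auto simp: le_Suc_eq)
  then show ?thesis by simp
qed

lemma rejections_0 [simp]: "rejections f z0 z1 0 = 0"
  by (simp add: rejections_def num_rejected_def)

lemma rejections_Suc:
  "rejections f z0 z1 (Suc t) = rejections f z0 z1 t + (if rejects f z0 z1 (Suc t) then 1 else 0)"
  by (simp add: rejections_def num_rejected_def rejects_def Let_def)

lemma alloc_Suc:
  "alloc f z0 z1 (Suc t) = (if rejects f z0 z1 (Suc t) then z1 (rejections f z0 z1 t) else z0 (Suc t))"
  by (simp add: alloc_def place_def rejects_def rejections_def)

lemma rejections_eq_card: "rejections f z0 z1 t = card {i \<in> {1..t}. rejects f z0 z1 i}"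
  by (induction t) (simp_all only: rejections_Suc card_filter_Suc rejections_0, simp)

lemma rejections_mono: "a \<le> b \<Longrightarrow> rejections f z0 z1 a \<le> rejections f z0 z1 b"
  unfolding rejections_eq_card by (intro card_mono) auto

lemma rejections_le: "rejections f z0 z1 t \<le> t"
  unfolding rejections_eq_card using card_mono[of "{1..t}" "{i \<in> {1..t}. rejects f z0 z1 i}"] by fastforce

lemma hits_lessThan_Suc: "hits z {..<Suc r} m = hits z {..<r} m + (if z r = m then 1 else 0)"
proof -
  have "{i \<in> {..<Suc r}. z i = m} = {i \<in> {..<r}. z i = m} \<union> (if z r = m then {r} else {})"
    by (auto simp: less_Suc_eq)
  then show ?thesis by (simp add: hits_def)
qed

text \<open>
  The pool of secondary allocations is consumed in order, so the rejected balls put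
  into a bin are counted by the hits of an initial segment of the pool.
\<close>

lemma load_eq_accepted_plus_hits:
  "load f z0 z1 t m = accepted f z0 z1 t m + hits z1 {..<rejections f z0 z1 t} m"
proof (induction t)
  case 0
  then show ?case by (simp add: load_def accepted_def hits_def)
next
  case (Suc t)
  show ?case
    using Suc unfolding load_def accepted_def card_filter_Suc alloc_Suc rejections_Suc
    by (auto simp: hits_lessThan_Suc)
qed

lemma load_ge_load_plus_hits:
  assumes "a \<le> b"
  shows "load f z0 z1 a m + hits z1 {rejections f z0 z1 a..<rejections f z0 z1 b} m \<le> load f z0 z1 b m"
proof -
  let ?a = "rejections f z0 z1 a" and ?b = "rejections f z0 z1 b"
  have ab: "?a \<le> ?b" using assms by (rule rejections_mono)
  have "{i \<in> {..<?b}. z1 i = m} = {i \<in> {..<?a}. z1 i = m} \<union> {i \<in> {?a..<?b}. z1 i = m}"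
    using ab by auto
  moreover have "card \<dots> = hits z1 {..<?a} m + hits z1 {?a..<?b} m"
    unfolding hits_def by (intro card_Un_disjoint) auto
  ultimately have "hits z1 {..<?b} m = hits z1 {..<?a} m + hits z1 {?a..<?b} m"
    by (simp add: hits_def)
  moreover have "accepted f z0 z1 a m \<le> accepted f z0 z1 b m"
    unfolding accepted_def using assms by (intro card_mono) auto
  ultimately show ?thesis by (simp add: load_eq_accepted_plus_hits)
qed

lemma load_ge_hits_if_no_rejection:
  assumes "\<And>i. i \<in> {a<..b} \<Longrightarrow> z0 i = m \<Longrightarrow> \<not> rejects f z0 z1 i"
  shows "hits z0 {a<..b} m \<le> load f z0 z1 b m"
proof -
  have "hits z0 {a<..b} m \<le> accepted f z0 z1 b m"
    unfolding hits_def accepted_def using assms by (intro card_mono) auto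
  then show ?thesis by (simp add: load_eq_accepted_plus_hits)
qed

lemma card_bins_with_rejection_le:
  assumes "a \<le> b"
  shows "card (z0 ` {i \<in> {a<..b}. rejects f z0 z1 i}) \<le> rejections f z0 z1 b - rejections f z0 z1 a"
proof -
  have "{i \<in> {1..b}. rejects f z0 z1 i}
      = {i \<in> {1..a}. rejects f z0 z1 i} \<union> {i \<in> {a<..b}. rejects f z0 z1 i}"
    using assms by auto
  moreover have "card \<dots> = card {i \<in> {1..a}. rejects f z0 z1 i} + card {i \<in> {a<..b}. rejects f z0 z1 i}"
    by (intro card_Un_disjoint) auto
  ultimately have "rejections f z0 z1 b - rejections f z0 z1 a = card {i \<in> {a<..b}. rejects f z0 z1 i}"
    by (simp add: rejections_eq_card)
  then show ?thesis by (simp add: card_image_le)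
qed

text \<open>
  The history depends on no secondary allocation beyond those already consumed. This makes
  the rest of the pool independent of the past.
\<close>

lemma history_upto_cong:
  assumes "\<And>i. i \<in> {1..t} \<Longrightarrow> z0 i = z0' i" "\<And>i. i < rejections f z0 z1 t \<Longrightarrow> z1 i = z1' i"
  shows "history_upto f z0' z1' t = history_upto f z0 z1 t"
  using assms
proof (induction t)
  case 0
  then show ?case by simp
next
  case (Suc t)
  have "z1 i = z1' i" if "i < rejections f z0 z1 t" for i
    using Suc.prems(2) that rejections_mono[of t "Suc t" f z0 z1] by simp
  then have h: "history_upto f z0' z1' t = history_upto f z0 z1 t"
    using Suc.prems(1) by (intro Suc.IH) auto
  have z: "z0' (Suc t) = z0 (Suc t)" using Suc.prems(1)[of "Suc t"] by simp
  have "place f z1' (history_upto f z0 z1 t) (z0 (Suc t)) = place f z1 (history_upto f z0 z1 t) (z0 (Suc t))"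
  proof (cases "rejects f z0 z1 (Suc t)")
    case True
    then have "z1 (rejections f z0 z1 t) = z1' (rejections f z0 z1 t)"
      by (intro Suc.prems(2)) (simp add: rejections_Suc)
    then show ?thesis unfolding place_def rejections_def by presburger
  next
    case False
    then show ?thesis by (simp add: place_def rejects_def)
  qed
  then show ?case by (simp add: h z Let_def)
qed

lemma load_eq_count_list: "load f z0 z1 t m = count_list (map (snd \<circ> snd) (history_upto f z0 z1 t)) m"
proof (induction t)
  case 0
  then show ?case by (simp add: load_def)
next
  case (Suc t)
  then show ?case
    unfolding load_def card_filter_Suc by (simp add: alloc_def Let_def)
qed

lemma count_list_primaries: "count_list (map fst (history_upto f z0 z1 t)) m = hits z0 {1..t} m"
proof (induction t)
  case 0
  then show ?case by (simp add: hits_def)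
next
  case (Suc t)
  then show ?case
    unfolding hits_def card_filter_Suc by (simp add: Let_def)
qed

lemma rejects_threshold_iff:
  assumes "t \<ge> 1"
  shows "rejects (threshold_strategy l) z0 z1 t \<longleftrightarrow> l \<le> real (hits z0 {1..t} (z0 t))"
proof -
  obtain s where t: "t = Suc s" using assms by (cases t) auto
  have "hits z0 {1..Suc s} (z0 (Suc s)) = hits z0 {1..s} (z0 (Suc s)) + 1"
    unfolding hits_def card_filter_Suc by simp
  then show ?thesis
    by (simp add: t rejects_def threshold_strategy_def count_list_primaries del: atLeastAtMostSuc_conv)
qed

text \<open>
  Consider the last accepted ball of the bin: being accepted, it is preceded by so few primary
  allocations to the bin that, itself included, they number less than \<open>l\<close>.
\<close>

lemma accepted_threshold_le:
  assumes "l \<ge> 0"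
  shows "real (accepted (threshold_strategy l) z0 z1 t m) \<le> l"
proof (cases "{i \<in> {1..t}. \<not> rejects (threshold_strategy l) z0 z1 i \<and> z0 i = m} = {}")
  case True
  then show ?thesis using assms by (simp only: accepted_def) simp
next
  case False
  let ?S = "{i \<in> {1..t}. \<not> rejects (threshold_strategy l) z0 z1 i \<and> z0 i = m}"
  define i where "i = Max ?S"
  have fin: "finite ?S" by simp
  have i: "i \<in> ?S" unfolding i_def by (rule Max_in[OF fin False])
  have "?S \<subseteq> {j \<in> {1..i}. z0 j = m}" using Max_ge[OF fin] by (auto simp: i_def)
  then have "accepted (threshold_strategy l) z0 z1 t m \<le> hits z0 {1..i} m"
    unfolding accepted_def hits_def by (intro card_mono) auto
  moreover have "real (hits z0 {1..i} m) < l"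
    using i rejects_threshold_iff[of i l z0 z1] by auto
  ultimately show ?thesis by linarith
qed

section \<open>Events of the process and the upper bound for a fixed number of bins\<close>

text \<open>The binomial probability that a given one of \<open>n\<close> bins is hit by exactly \<open>k\<close> of \<open>w\<close> uniform balls.\<close>

definition hit_prob :: "nat \<Rightarrow> nat \<Rightarrow> nat \<Rightarrow> real" where
  "hit_prob n w k = real (w choose k) * (1 / real n) ^ k * (1 - 1 / real n) ^ (w - k)"

definition heavy_bins ::
    "nat \<Rightarrow> strategy \<Rightarrow> (nat \<Rightarrow> nat) \<Rightarrow> (nat \<Rightarrow> nat) \<Rightarrow> nat \<Rightarrow> nat \<Rightarrow> nat set" where
  "heavy_bins n f z0 z1 t c = {m \<in> {1..n}. c \<le> load f z0 z1 t m}"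

lemma hits_comp_inj: "inj h \<Longrightarrow> hits (x \<circ> h) W m = hits x (h ` W) m"
proof -
  assume h: "inj h"
  have "{i \<in> h ` W. x i = m} = h ` {i \<in> W. (x \<circ> h) i = m}" by auto
  then show ?thesis unfolding hits_def using h by (simp add: card_image inj_on_def)
qed

lemmas hits_Inl = hits_comp_inj[OF inj_Inl] and hits_Inr = hits_comp_inj[OF inj_Inr]

text \<open>
  On the event that exactly \<open>r\<close> of the first \<open>t\<close> balls are rejected, properties of the history look only
  at the secondary allocations below \<open>r\<close>. Hence they are independent of the allocations from \<open>r\<close> on,
  although the number of rejections itself is random.
\<close>

lemma determined_by_history_given_rejections:
  "determined_by (\<lambda>x. rejections f (x \<circ> Inl) (x \<circ> Inr) t = r \<and> Q (history_upto f (x \<circ> Inl) (x \<circ> Inr) t))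
     (Inl ` {1..t} \<union> Inr ` {..<r})"
proof (rule determined_byI)
  fix x y :: "nat + nat \<Rightarrow> nat"
  assume xy: "\<And>i. i \<in> Inl ` {1..t} \<union> Inr ` {..<r} \<Longrightarrow> x i = y i"
  have *: "history_upto f (y \<circ> Inl) (y \<circ> Inr) t = history_upto f (x \<circ> Inl) (x \<circ> Inr) t"
    if "rejections f (x \<circ> Inl) (x \<circ> Inr) t = r"
    using xy that by (intro history_upto_cong) auto
  have **: "history_upto f (x \<circ> Inl) (x \<circ> Inr) t = history_upto f (y \<circ> Inl) (y \<circ> Inr) t"
    if "rejections f (y \<circ> Inl) (y \<circ> Inr) t = r"
    using xy[symmetric] that by (intro history_upto_cong) auto
  show "(rejections f (x \<circ> Inl) (x \<circ> Inr) t = r \<and> Q (history_upto f (x \<circ> Inl) (x \<circ> Inr) t)) =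
    (rejections f (y \<circ> Inl) (y \<circ> Inr) t = r \<and> Q (history_upto f (y \<circ> Inl) (y \<circ> Inr) t))"
    using * ** unfolding rejections_def by metis
qed

lemma determined_by_history:
  "determined_by (\<lambda>x. Q (history_upto f (x \<circ> Inl) (x \<circ> Inr) t)) (Inl ` {1..t} \<union> Inr ` {..<t})"
proof (rule determined_byI)
  fix x y :: "nat + nat \<Rightarrow> nat"
  assume xy: "\<And>i. i \<in> Inl ` {1..t} \<union> Inr ` {..<t} \<Longrightarrow> x i = y i"
  have "history_upto f (y \<circ> Inl) (y \<circ> Inr) t = history_upto f (x \<circ> Inl) (x \<circ> Inr) t"
    using xy rejections_le[of f "x \<circ> Inl" "x \<circ> Inr" t] by (intro history_upto_cong) auto
  then show "Q (history_upto f (x \<circ> Inl) (x \<circ> Inr) t) = Q (history_upto f (y \<circ> Inl) (y \<circ> Inr) t)"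
    by (simp only:)
qed

lemma determined_by_load:
  "determined_by (\<lambda>x. Q (load f (x \<circ> Inl) (x \<circ> Inr) t)) (Inl ` {1..t} \<union> Inr ` {..<t})"
proof -
  have *: "load f z0 z1 t = count_list (map (snd \<circ> snd) (history_upto f z0 z1 t))" for z0 z1
    by (intro ext load_eq_count_list)
  show ?thesis
    unfolding * by (rule determined_by_history[where Q = "\<lambda>h. Q (count_list (map (snd \<circ> snd) h))"])
qed

lemma determined_by_heavy_bins:
  "determined_by (\<lambda>x. rejections f (x \<circ> Inl) (x \<circ> Inr) t = r \<and> heavy_bins n f (x \<circ> Inl) (x \<circ> Inr) t c = B)
     (Inl ` {1..t} \<union> Inr ` {..<r})"
  unfolding heavy_bins_def load_eq_count_list
  by (rule determined_by_history_given_rejections[where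
        Q = "\<lambda>h. {m \<in> {1..n}. c \<le> count_list (map (snd \<circ> snd) h) m} = B"])

text \<open>
  Both sequences form one family indexed by \<open>nat + nat\<close>: \<open>Inl\<close> indexes the primary and \<open>Inr\<close> the
  secondary allocations.
\<close>

sublocale two_thinning_source \<subseteq> uniform_allocation M n "case_sum Z0 Z1"
proof
  show "indep_vars (\<lambda>_. count_space {1..n}) (case_sum Z0 Z1) UNIV" by (rule indep)
  show "distr M (count_space {1..n}) (case_sum Z0 Z1 i) = uniform_count_measure {1..n}" for i
    by (cases i) (simp_all only: sum.case uniform0 uniform1)
qed

context two_thinning_source
begin

lemma MaxLoad_event:
  "{\<omega> \<in> space M. Q (MaxLoad n f Z0 Z1 t \<omega>)} =
   event (\<lambda>x. Q (real (Max (load f (x \<circ> Inl) (x \<circ> Inr) (nat \<lfloor>t\<rfloor>) ` {1..n}))))"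
  by (simp add: event_def MaxLoad_def max_load_eq o_def)

lemma MaxLoad_event_measurable: "{\<omega> \<in> space M. Q (MaxLoad n f Z0 Z1 t \<omega>)} \<in> events"
  unfolding MaxLoad_event
  by (rule event_measurable[OF _ determined_by_load[where Q = "\<lambda>L. Q (real (Max (L ` {1..n})))"]]) auto

lemma MaxLoad_measurable: "MaxLoad n f Z0 Z1 t \<in> borel_measurable M"
proof -
  have "{\<omega> \<in> space M. a \<le> MaxLoad n f Z0 Z1 t \<omega>} \<in> events" for a
    by (rule MaxLoad_event_measurable)
  then show ?thesis by (simp add: borel_measurable_iff_ge)
qed

text \<open>
  A ball is rejected only if more than \<open>k\<close> primary allocations went to its bin, of which at least \<open>k\<close>
  come from earlier balls; the bin suggested to the ball is independent of these.
\<close>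

lemma prob_rejects_threshold_le:
  assumes t: "t \<ge> 1" "t \<le> T" and k: "real k < l"
  shows "prob (event (\<lambda>x. rejects (threshold_strategy l) (x \<circ> Inl) (x \<circ> Inr) t))
           \<le> real (T choose k) / real n ^ k"
proof -
  let ?A = "Inl ` {1..<t} :: (nat + nat) set" and ?B = "{Inl t :: nat + nat}"
  have "prob (event (\<lambda>x. rejects (threshold_strategy l) (x \<circ> Inl) (x \<circ> Inr) t))
    \<le> (\<Sum>m\<in>{1..n}. prob (event (\<lambda>x. x (Inl t) \<in> {m} \<and> k \<le> hits x ?A m)))"
  proof (rule prob_event_union_bound)
    show "finite (?A \<union> ?B)" by simp
    show "determined_by (\<lambda>x. x (Inl t) \<in> {m} \<and> k \<le> hits x ?A m) (?A \<union> ?B)" for m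
    proof (rule determined_byI)
      fix x y :: "nat + nat \<Rightarrow> nat"
      assume xy: "\<And>i. i \<in> ?A \<union> ?B \<Longrightarrow> x i = y i"
      have "hits x ?A m = hits y ?A m" using xy by (intro hits_cong) blast
      moreover have "x (Inl t) = y (Inl t)" by (rule xy) simp
      ultimately show "(x (Inl t) \<in> {m} \<and> k \<le> hits x ?A m) = (y (Inl t) \<in> {m} \<and> k \<le> hits y ?A m)"
        by (simp only:)
    qed
    fix x :: "nat + nat \<Rightarrow> nat"
    assume x: "\<And>i. x i \<in> {1..n}" and rej: "rejects (threshold_strategy l) (x \<circ> Inl) (x \<circ> Inr) t"
    obtain s where s: "t = Suc s" using t by (cases t) auto
    have "l \<le> real (hits (x \<circ> Inl) {1..t} (x (Inl t)))"
      using rej rejects_threshold_iff[OF t(1), of l "x \<circ> Inl" "x \<circ> Inr"] by simp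
    also have "hits (x \<circ> Inl) {1..t} (x (Inl t)) = hits (x \<circ> Inl) {1..<t} (x (Inl t)) + 1"
      unfolding s hits_def card_filter_Suc atLeastLessThanSuc_atLeastAtMost by simp
    finally have "k \<le> hits x ?A (x (Inl t))" using k unfolding hits_Inl by linarith
    then show "\<exists>m\<in>{1..n}. x (Inl t) \<in> {m} \<and> k \<le> hits x ?A m" using x by blast
  qed simp
  also have "\<dots> \<le> (\<Sum>m\<in>{1..n}. 1 / n * (real (T choose k) / real n ^ k))"
  proof (rule sum_mono)
    fix m assume m: "m \<in> {1..n}"
    have "prob (event (\<lambda>x. x (Inl t) \<in> {m} \<and> k \<le> hits x ?A m))
      = prob (event (\<lambda>x. x (Inl t) \<in> {m})) * prob (event (\<lambda>x. k \<le> hits x ?A m))"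
    proof (rule prob_event_indep)
      show "determined_by (\<lambda>x. x (Inl t) \<in> {m}) ?B" by (rule determined_byI) simp
      show "determined_by (\<lambda>x. k \<le> hits x ?A m) ?A"
        by (rule determined_by_hits[where Q = "\<lambda>h. k \<le> h m"])
    qed auto
    also have "prob (event (\<lambda>x. x (Inl t) \<in> {m})) = 1 / n"
      using prob_box[of ?B "\<lambda>_. {m}"] m by simp
    also have "prob (event (\<lambda>x. k \<le> hits x ?A m)) \<le> real (card ?A choose k) / real n ^ k"
      by (rule prob_hits_ge_le[OF _ m]) simp
    also have "\<dots> \<le> real (T choose k) / real n ^ k"
      using t by (intro divide_right_mono) (auto simp: card_image intro!: binomial_right_mono)
    finally show "prob (event (\<lambda>x. x (Inl t) \<in> {m} \<and> k \<le> hits x ?A m))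
      \<le> 1 / n * (real (T choose k) / real n ^ k)"
      by (simp add: mult_left_mono divide_right_mono)
  qed
  also have "\<dots> = real (T choose k) / real n ^ k" using n_pos by simp
  finally show ?thesis .
qed

text \<open>
  If a bin has load \<open>l + s\<close>, then at least \<open>s\<close> of its balls are secondary ones, since at most
  \<open>l\<close> were accepted. So either at least \<open>v\<close> balls were rejected, or some bin is hit \<open>s\<close> times by the first
  \<open>v\<close> secondary allocations. The first summand bounds the former by Markov's inequality, the second one
  the latter by the union bound.
\<close>

theorem prob_MaxLoad_threshold_ge_le:
  assumes k: "real k < l" and v: "v > 0" and T: "T = nat \<lfloor>t\<rfloor>" 
  shows "prob {\<omega> \<in> space M. l + real s \<le> MaxLoad n (threshold_strategy l) Z0 Z1 t \<omega>}
    \<le> real T * (real (T choose k) / real n ^ k) / real v + real n * (real (v choose s) / real n ^ s)"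
proof -
  let ?f = "threshold_strategy l"
  let ?R = "event (\<lambda>x. v \<le> rejections ?f (x \<circ> Inl) (x \<circ> Inr) T)"
  let ?S = "\<lambda>m. event (\<lambda>x. s \<le> hits x (Inr ` {..<v}) m)"
  let ?rej = "\<lambda>i. event (\<lambda>x. rejects ?f (x \<circ> Inl) (x \<circ> Inr) i)"
  have Rm: "?R \<in> events"
    unfolding rejections_def by (rule event_measurable[OF _ determined_by_history[where Q = "\<lambda>h. v \<le> num_rejected h"]]) auto
  have Sm: "?S m \<in> events" for m
    by (rule event_measurable[OF _ determined_by_hits[where Q = "\<lambda>h. s \<le> h m"]]) auto
  have rejm: "?rej i \<in> events" for i
  proof (rule event_measurable)
    show "determined_by (\<lambda>x. rejects ?f (x \<circ> Inl) (x \<circ> Inr) i) (Inl ` {1..i} \<union> Inr ` {..<i} \<union> {Inl i})"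
    proof (rule determined_byI)
      fix x y :: "nat + nat \<Rightarrow> nat"
      assume xy: "\<And>j. j \<in> Inl ` {1..i} \<union> Inr ` {..<i} \<union> {Inl i} \<Longrightarrow> x j = y j"
      have "history_upto ?f (y \<circ> Inl) (y \<circ> Inr) (i - 1) = history_upto ?f (x \<circ> Inl) (x \<circ> Inr) (i - 1)"
      proof (rule history_upto_cong)
        show "(x \<circ> Inl) j = (y \<circ> Inl) j" if "j \<in> {1..i - 1}" for j
          using that xy[of "Inl j"] by auto
        show "(x \<circ> Inr) j = (y \<circ> Inr) j" if "j < rejections ?f (x \<circ> Inl) (x \<circ> Inr) (i - 1)" for j
          using that xy[of "Inr j"] rejections_le[of ?f "x \<circ> Inl" "x \<circ> Inr" "i - 1"] by auto
      qed
      moreover have "x (Inl i) = y (Inl i)" by (rule xy) simp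
      ultimately show "rejects ?f (x \<circ> Inl) (x \<circ> Inr) i = rejects ?f (y \<circ> Inl) (y \<circ> Inr) i"
        by (simp add: rejects_def)
    qed
  qed simp
  have "{\<omega> \<in> space M. l + real s \<le> MaxLoad n ?f Z0 Z1 t \<omega>} \<subseteq> ?R \<union> (\<Union>m\<in>{1..n}. ?S m)"
  proof
    fix \<omega> assume "\<omega> \<in> {\<omega> \<in> space M. l + real s \<le> MaxLoad n ?f Z0 Z1 t \<omega>}"
    then have \<omega>: "\<omega> \<in> space M" and ge: "l + real s \<le> MaxLoad n ?f Z0 Z1 t \<omega>" by auto
    define x where "x = (\<lambda>i. case_sum Z0 Z1 i \<omega>)"
    let ?L = "load ?f (x \<circ> Inl) (x \<circ> Inr) T"
    have "Max (?L ` {1..n}) \<in> ?L ` {1..n}" using n_pos by (intro Max_in) auto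
    then obtain m where m: "m \<in> {1..n}" and "Max (?L ` {1..n}) = ?L m" by blast
    then have "l + real s \<le> real (?L m)" using ge by (simp add: MaxLoad_def max_load_eq T x_def o_def)
    also have "?L m = accepted ?f (x \<circ> Inl) (x \<circ> Inr) T m + hits (x \<circ> Inr) {..<rejections ?f (x \<circ> Inl) (x \<circ> Inr) T} m"
      by (rule load_eq_accepted_plus_hits)
    finally have "real s \<le> real (hits (x \<circ> Inr) {..<rejections ?f (x \<circ> Inl) (x \<circ> Inr) T} m)"
      using accepted_threshold_le[of l "x \<circ> Inl" "x \<circ> Inr" T m] k by simp
    then have s: "s \<le> hits (x \<circ> Inr) {..<rejections ?f (x \<circ> Inl) (x \<circ> Inr) T} m" by simp
    show "\<omega> \<in> ?R \<union> (\<Union>m\<in>{1..n}. ?S m)"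
    proof (cases "v \<le> rejections ?f (x \<circ> Inl) (x \<circ> Inr) T")
      case True
      then show ?thesis using \<omega> by (auto simp: event_def x_def)
    next
      case False
      then have "hits (x \<circ> Inr) {..<rejections ?f (x \<circ> Inl) (x \<circ> Inr) T} m \<le> hits (x \<circ> Inr) {..<v} m"
        unfolding hits_def by (intro card_mono) auto
      then have "s \<le> hits x (Inr ` {..<v}) m" using s unfolding hits_Inr by linarith
      then have "\<omega> \<in> ?S m" using \<omega> unfolding event_def x_def by blast
      then show ?thesis using m by blast
    qed
  qed
  then have "prob {\<omega> \<in> space M. l + real s \<le> MaxLoad n ?f Z0 Z1 t \<omega>} \<le> prob (?R \<union> (\<Union>m\<in>{1..n}. ?S m))"
    using Rm Sm by (intro finite_measure_mono) auto
  also have "\<dots> \<le> prob ?R + prob (\<Union>m\<in>{1..n}. ?S m)"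
    using Rm Sm by (intro measure_Un_le) auto
  also have "prob (\<Union>m\<in>{1..n}. ?S m) \<le> (\<Sum>m\<in>{1..n}. prob (?S m))"
    using Sm by (intro finite_measure_subadditive_finite) auto
  also have "\<dots> \<le> (\<Sum>m\<in>{1..n}. real (v choose s) / real n ^ s)"
  proof (rule sum_mono)
    fix m assume "m \<in> {1..n}"
    then show "prob (?S m) \<le> real (v choose s) / real n ^ s"
      using prob_hits_ge_le[of "Inr ` {..<v}" m s] by (simp add: card_image)
  qed
  also have "?R = {\<omega> \<in> space M. real v \<le> real (card {i \<in> {1..T}. \<omega> \<in> ?rej i})}"
    unfolding event_def rejections_eq_card by auto
  also have "prob \<dots> \<le> (\<Sum>i\<in>{1..T}. prob (?rej i)) / real v"
    using v rejm by (intro prob_count_ge_le) auto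
  also have "\<dots> \<le> (\<Sum>i\<in>{1..T}. real (T choose k) / real n ^ k) / real v"
    by (intro divide_right_mono sum_mono prob_rejects_threshold_le[OF _ _ k]) auto
  finally show ?thesis by simp
qed

end

section \<open>The lower bound for a fixed number of bins\<close>

lemma load_mono: "a \<le> b \<Longrightarrow> load f z0 z1 a m \<le> load f z0 z1 b m"
  unfolding load_def by (intro card_mono) auto

text \<open>
  One phase, from ball \<open>a\<close> to ball \<open>b\<close>. If at least \<open>v\<close> balls are rejected, the \<open>v\<close> secondary allocations
  that come next in the pool are all used, and they raise some bin of \<open>B\<close> by \<open>s\<close>. If
  fewer than \<open>v\<close> are rejected, they spoil fewer than \<open>v\<close> of the \<open>2 * v\<close> bins that received \<open>k\<close> primary
  allocations in the phase, and the others keep all \<open>k\<close> of them.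
\<close>

lemma heavy_bins_step:
  fixes a b c k s u v n :: nat and f :: strategy and z0 z1 :: "nat \<Rightarrow> nat"
  defines "R \<equiv> rejections f z0 z1 a" and "B \<equiv> heavy_bins n f z0 z1 a c"
  assumes ab: "a \<le> b"
    and prim: "2 * v \<le> card {m \<in> {1..n}. hits z0 {a<..b} m = k}"
    and sec: "u \<le> card B \<Longrightarrow> \<exists>m\<in>B. s \<le> hits z1 {R..<R + v} m"
    and B: "u \<le> card B" 
  shows "v \<le> card (heavy_bins n f z0 z1 b k) \<or> (\<exists>m\<in>{1..n}. c + s \<le> load f z0 z1 b m)"
proof (cases "R + v \<le> rejections f z0 z1 b")
  case True
  obtain m where m: "m \<in> B" "s \<le> hits z1 {R..<R + v} m" using sec B by blast
  have "hits z1 {R..<R + v} m \<le> hits z1 {R..<rejections f z0 z1 b} m"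
    unfolding hits_def using True by (intro card_mono) auto
  then have "c + s \<le> load f z0 z1 b m"
    using load_ge_load_plus_hits[OF ab, of f z0 z1 m] m by (simp add: B_def heavy_bins_def R_def)
  then show ?thesis using m(1) by (auto simp: B_def heavy_bins_def)
next
  case False
  let ?H = "{m \<in> {1..n}. hits z0 {a<..b} m = k}" and ?J = "z0 ` {i \<in> {a<..b}. rejects f z0 z1 i}"
  have "card ?J \<le> v"
    using card_bins_with_rejection_le[OF ab, of z0 f z1] False by (simp add: R_def)
  then have "v \<le> card ?H - card ?J" using prim by linarith
  also have "\<dots> \<le> card (?H - ?J)" by (rule diff_card_le_card_Diff) simp
  also have "\<dots> \<le> card (heavy_bins n f z0 z1 b k)"
  proof (rule card_mono)
    show "?H - ?J \<subseteq> heavy_bins n f z0 z1 b k"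
    proof
      fix m assume m: "m \<in> ?H - ?J"
      then have "hits z0 {a<..b} m \<le> load f z0 z1 b m"
        by (intro load_ge_hits_if_no_rejection) blast
      then show "m \<in> heavy_bins n f z0 z1 b k" using m by (auto simp: heavy_bins_def)
    qed
  qed (simp add: heavy_bins_def)
  finally show ?thesis by blast
qed

context two_thinning_source
begin

text \<open>
  The set of heavy bins and the position \<open>R\<close> in the pool are random but known at time \<open>t\<close>. For each of their
  possible values \<open>B\<close> and \<open>r\<close> the hits of the next \<open>v\<close> secondary allocations are independent of the
  event that these values are attained. Those events are disjoint, so the bound \<open>\<beta>\<close>
  that is uniform in \<open>B\<close> and \<open>r\<close> survives the summation.
\<close>

lemma prob_no_bin_in_random_set_hit_le:
  assumes Q: "\<And>r B. r \<le> t \<Longrightarrow> B \<subseteq> {1..n} \<Longrightarrow> u \<le> card B \<Longrightarrow>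
      prob (event (\<lambda>x. \<forall>m\<in>B. hits x (Inr ` {r..<r + v}) m < s)) \<le> \<beta>" and "\<beta> \<ge> 0"
  shows "prob (event (\<lambda>x. u \<le> card (heavy_bins n f (x \<circ> Inl) (x \<circ> Inr) t c) \<and>
      (\<forall>m\<in>heavy_bins n f (x \<circ> Inl) (x \<circ> Inr) t c.
        hits (x \<circ> Inr) {rejections f (x \<circ> Inl) (x \<circ> Inr) t..<rejections f (x \<circ> Inl) (x \<circ> Inr) t + v} m < s)))
    \<le> \<beta>" (is "prob (event ?P) \<le> _")
proof -
  let ?I = "{..t} \<times> {B. B \<subseteq> {1..n} \<and> u \<le> card B}"
  let ?H = "\<lambda>(r, B) x. rejections f (x \<circ> Inl) (x \<circ> Inr) t = r \<and> heavy_bins n f (x \<circ> Inl) (x \<circ> Inr) t c = B"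
  let ?S = "\<lambda>(r, B) x. \<forall>m\<in>B. hits x (Inr ` {r..<r + v}) m < s"
  let ?A = "\<lambda>r :: nat. Inl ` {1..t} \<union> Inr ` {..<r} :: (nat + nat) set"
  let ?D = "\<lambda>r. Inr ` {r..<r + v} :: (nat + nat) set"
  have fin: "finite ?I" by simp
  have detH: "determined_by (?H (r, B)) (?A r)" for r B
    using determined_by_heavy_bins by simp
  have detS: "determined_by (?S (r, B)) (?D r)" for r B
    using determined_by_hits[where Q = "\<lambda>h. \<forall>m\<in>B. h m < s"] by simp
  have "prob (event ?P) \<le> (\<Sum>i\<in>?I. prob (event (\<lambda>x. ?H i x \<and> ?S i x)))"
  proof (rule prob_event_union_bound[OF fin])
    show "finite (Inl ` {1..t} \<union> Inr ` {..<t + v} :: (nat + nat) set)" by simp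
    show "determined_by (\<lambda>x. ?H i x \<and> ?S i x) (Inl ` {1..t} \<union> Inr ` {..<t + v})" if iI: "i \<in> ?I" for i
    proof -
      obtain r B where i: "i = (r, B)" "r \<le> t" using iI by auto
      show ?thesis
      proof (rule determined_byI)
        fix x y :: "nat + nat \<Rightarrow> nat"
        assume xy: "\<And>j. j \<in> Inl ` {1..t} \<union> Inr ` {..<t + v} \<Longrightarrow> x j = y j"
        have "?H i x = ?H i y"
          unfolding i(1) by (rule determined_byD[OF detH]) (use xy i(2) in auto)
        moreover have "?S i x = ?S i y"
          unfolding i(1) by (rule determined_byD[OF detS]) (use xy i(2) in auto)
        ultimately show "(?H i x \<and> ?S i x) = (?H i y \<and> ?S i y)" by (simp only:)
      qed
    qed
    fix x :: "nat + nat \<Rightarrow> nat"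
    assume P: "?P x"
    let ?r = "rejections f (x \<circ> Inl) (x \<circ> Inr) t" and ?B = "heavy_bins n f (x \<circ> Inl) (x \<circ> Inr) t c"
    show "\<exists>i\<in>?I. ?H i x \<and> ?S i x"
    proof (rule bexI[of _ "(?r, ?B)"])
      show "?H (?r, ?B) x \<and> ?S (?r, ?B) x" using P by (simp add: hits_Inr)
      have "?B \<subseteq> {1..n}" unfolding heavy_bins_def by blast
      then show "(?r, ?B) \<in> ?I" using P rejections_le by simp
    qed
  qed
  also have "\<dots> \<le> (\<Sum>i\<in>?I. \<beta> * prob (event (?H i)))"
  proof (rule sum_mono)
    fix i assume "i \<in> ?I"
    then obtain r B where i: "i = (r, B)" "r \<le> t" "B \<subseteq> {1..n}" "u \<le> card B" by auto
    have "prob (event (\<lambda>x. ?H (r, B) x \<and> ?S (r, B) x)) = prob (event (?H (r, B))) * prob (event (?S (r, B)))"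
      by (rule prob_event_indep[OF _ detH _ detS]) auto
    also have "\<dots> \<le> prob (event (?H (r, B))) * \<beta>"
      using Q[OF i(2-4)] by (intro mult_left_mono) auto
    finally show "prob (event (\<lambda>x. ?H i x \<and> ?S i x)) \<le> \<beta> * prob (event (?H i))"
      unfolding i(1) by (simp only: mult.commute)
  qed
  also have "\<dots> = \<beta> * (\<Sum>i\<in>?I. prob (event (?H i)))" by (rule sum_distrib_left[symmetric])
  also have "(\<Sum>i\<in>?I. prob (event (?H i))) = prob (\<Union>i\<in>?I. event (?H i))"
  proof (rule finite_measure_finite_Union[OF fin, symmetric])
    have "event (?H i) \<in> events" for i
      by (cases i) (use event_measurable[OF _ detH] in auto)
    then show "(\<lambda>i. event (?H i)) ` ?I \<subseteq> events" by blast
    show "disjoint_family_on (\<lambda>i. event (?H i)) ?I"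
      unfolding disjoint_family_on_def event_def by auto
  qed
  also have "\<beta> * \<dots> \<le> \<beta> * 1" using \<open>\<beta> \<ge> 0\<close> by (intro mult_left_mono prob_le_1)
  finally show ?thesis by (simp only: mult_1_right)
qed

text \<open>
  Phase \<open>j\<close> consists of the balls in \<open>{j * w<..Suc j * w}\<close>. If the maximal load stays below \<open>K\<close>, then the second
  alternative of \<open>heavy_bins_step\<close> cannot occur in any phase, so by induction at least \<open>v j\<close> bins
  have load \<open>\<kappa> j\<close> at the start of phase \<open>j\<close>, and \<open>K \<le> \<kappa> N\<close> is contradicted at the end. The
  summand for \<open>j\<close> bounds the probability that an input of the step fails: that fewer than half of
  the expected number of bins receive \<open>\<kappa> (Suc j)\<close> primary allocations, or that none of the \<open>v j\<close> heavy bins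
  is hit \<open>s (Suc j)\<close> times by the next \<open>v (Suc j)\<close> secondary allocations.
\<close>

theorem prob_MaxLoad_less_le:
  fixes \<kappa> v s :: "nat \<Rightarrow> nat" and N w K :: nat
  assumes n2: "n \<ge> 2" and T: "N * w \<le> nat \<lfloor>t\<rfloor>"
    and start: "\<kappa> 0 = 0" "v 0 \<le> n" and v1: "\<And>j. v j \<ge> 1"
    and target: "\<And>j. j < N \<Longrightarrow> K \<le> \<kappa> j + s (Suc j)" "K \<le> \<kappa> N"
    and prim: "\<And>j. j < N \<Longrightarrow> \<kappa> (Suc j) \<le> w"
      "\<And>j. j < N \<Longrightarrow> 2 * real (v (Suc j)) \<le> n * hit_prob n w (\<kappa> (Suc j)) / 2"
    and sec: "\<And>j. j < N \<Longrightarrow> s (Suc j) \<le> v (Suc j)"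
  shows "prob {\<omega> \<in> space M. MaxLoad n f Z0 Z1 t \<omega> < K} \<le>
    (\<Sum>j<N. 4 / (n * hit_prob n w (\<kappa> (Suc j))) + 4 * (1 / (1 - 1 / n) ^ (2 * \<kappa> (Suc j)) - 1)
         + (4 / (v j * hit_prob n (v (Suc j)) (s (Suc j))) + 4 * (1 / (1 - 1 / n) ^ (2 * s (Suc j)) - 1)))"
    (is "_ \<le> (\<Sum>j<N. ?\<alpha> j + ?\<beta> j)")
proof -
  let ?T = "nat \<lfloor>t\<rfloor>"
  let ?W = "\<lambda>j. Inl ` {j * w<..Suc j * w} :: (nat + nat) set"
  let ?G = "\<lambda>j. event (\<lambda>x. real (card {m \<in> {1..n}. hits x (?W j) m = \<kappa> (Suc j)})
      < card {1..n} * hit_prob n w (\<kappa> (Suc j)) / 2)"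
  let ?B = "\<lambda>x j. heavy_bins n f (x \<circ> Inl) (x \<circ> Inr) (j * w) (\<kappa> j)"
  let ?R = "\<lambda>x j. rejections f (x \<circ> Inl) (x \<circ> Inr) (j * w)"
  let ?C = "\<lambda>j. event (\<lambda>x. v j \<le> card (?B x j) \<and>
      (\<forall>m\<in>?B x j. hits (x \<circ> Inr) {?R x j..<?R x j + v (Suc j)} m < s (Suc j)))"
  have a: "0 < 1 - 1 / real n" "1 - 1 / real n \<le> 1" using n2 by simp_all
  have hp: "hit_prob n u k > 0" if "k \<le> u" for u k
    using that a n2 unfolding hit_prob_def by (simp add: zero_less_binomial)
  have pow_ge: "1 / (1 - 1 / real n) ^ k - 1 \<ge> 0" for k
    using a power_le_one[of "1 - 1 / real n" k] by (simp add: divide_simps)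
  have cW: "card (?W j) = w" for j by (simp add: card_image)
  have G: "prob (?G j) \<le> ?\<alpha> j" if j: "j < N" for j
  proof -
    have ne: "{1..n} \<noteq> {}" using n2 by auto
    have "hit_prob n w (\<kappa> (Suc j)) = real (card (?W j) choose \<kappa> (Suc j)) * (1 / real n) ^ \<kappa> (Suc j)
        * (1 - 1 / real n) ^ (card (?W j) - \<kappa> (Suc j))" unfolding hit_prob_def cW ..
    from prob_few_bins_with_hits_le[OF _ _ order_refl ne n2 this] prim(1)[OF j] show ?thesis
      unfolding cW by simp
  qed
  have \<beta>0: "?\<beta> j \<ge> 0" if "j < N" for j
    using pow_ge[of "2 * s (Suc j)"] hp[OF sec[OF that]] by simp
  have C: "prob (?C j) \<le> ?\<beta> j" if j: "j < N" for j
  proof (rule prob_no_bin_in_random_set_hit_le[OF _ \<beta>0[OF j]])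
    fix r B
    assume B: "B \<subseteq> {1..n}" "v j \<le> card B"
    let ?V = "Inr ` {r..<r + v (Suc j)} :: (nat + nat) set" and ?p = "hit_prob n (v (Suc j)) (s (Suc j))"
    have p: "?p > 0" by (rule hp[OF sec[OF j]])
    have cV: "card ?V = v (Suc j)" by (simp add: card_image)
    have cB: "card B \<ge> 1" using B(2) v1[of j] by linarith
    have fB: "finite B" using B(1) finite_subset by blast
    \<comment> \<open>Exact numbers of hits suffice here as well: if none of the bins is hit often enough, then none is
      hit exactly \<open>s (Suc j)\<close> times, which is less than half of the positive expected number.\<close>
    have "prob (event (\<lambda>x. \<forall>m\<in>B. hits x ?V m < s (Suc j)))
        \<le> prob (event (\<lambda>x. real (card {m \<in> B. hits x ?V m = s (Suc j)}) < card B * ?p / 2))"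
    proof (rule prob_event_mono[where A = ?V])
      show "determined_by (\<lambda>x. real (card {m \<in> B. hits x ?V m = s (Suc j)}) < card B * ?p / 2) ?V"
        by (rule determined_by_hits[where Q = "\<lambda>h. real (card {m \<in> B. h m = s (Suc j)}) < card B * ?p / 2"])
      fix x :: "nat + nat \<Rightarrow> nat"
      assume "\<forall>m\<in>B. hits x ?V m < s (Suc j)"
      then have none: "{m \<in> B. hits x ?V m = s (Suc j)} = {}" by fastforce
      show "real (card {m \<in> B. hits x ?V m = s (Suc j)}) < card B * ?p / 2"
        unfolding none using cB p by simp
    qed simp
    also have "\<dots> \<le> 4 / (card B * ?p) + 4 * (1 / (1 - 1 / n) ^ (2 * s (Suc j)) - 1)"
    proof (rule prob_few_bins_with_hits_le[OF _ _ B(1) _ n2])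
      show "s (Suc j) \<le> card ?V" unfolding cV by (rule sec[OF j])
      show "B \<noteq> {}" using cB by auto
      show "?p = real (card ?V choose s (Suc j)) * (1 / real n) ^ s (Suc j)
          * (1 - 1 / real n) ^ (card ?V - s (Suc j))" unfolding hit_prob_def cV ..
    qed simp
    also have "4 / (card B * ?p) \<le> 4 / (v j * ?p)"
      using B(2) v1[of j] p by (intro divide_left_mono mult_right_mono mult_pos_pos) auto
    finally show "prob (event (\<lambda>x. \<forall>m\<in>B. hits x ?V m < s (Suc j))) \<le> ?\<beta> j" by simp
  qed
  have Gm: "?G j \<in> events" for j
    by (rule event_measurable[OF _ determined_by_hits[where
          Q = "\<lambda>h. real (card {m \<in> {1..n}. h m = \<kappa> (Suc j)}) < card {1..n} * hit_prob n w (\<kappa> (Suc j)) / 2"]]) simp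
  have Cm: "?C j \<in> events" for j
  proof (rule event_measurable)
    let ?A = "Inl ` {1..j * w} \<union> Inr ` {..<j * w + v (Suc j)} :: (nat + nat) set"
    show "finite ?A" by simp
    let ?P = "\<lambda>h z. v j \<le> card {m \<in> {1..n}. \<kappa> j \<le> count_list (map (snd \<circ> snd) h) m} \<and>
      (\<forall>m\<in>{m \<in> {1..n}. \<kappa> j \<le> count_list (map (snd \<circ> snd) h) m}.
         hits z {num_rejected h..<num_rejected h + v (Suc j)} m < s (Suc j))"
    show "determined_by (\<lambda>x. v j \<le> card (?B x j) \<and>
      (\<forall>m\<in>?B x j. hits (x \<circ> Inr) {?R x j..<?R x j + v (Suc j)} m < s (Suc j))) ?A"
      unfolding heavy_bins_def load_eq_count_list rejections_def
    proof (rule determined_byI)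
      fix x y :: "nat + nat \<Rightarrow> nat"
      assume xy: "\<And>i. i \<in> ?A \<Longrightarrow> x i = y i"
      let ?h = "history_upto f (x \<circ> Inl) (x \<circ> Inr) (j * w)"
      have h: "history_upto f (y \<circ> Inl) (y \<circ> Inr) (j * w) = ?h"
        using xy rejections_le[of f "x \<circ> Inl" "x \<circ> Inr" "j * w"] by (intro history_upto_cong) auto
      have "num_rejected ?h \<le> j * w" using rejections_le unfolding rejections_def .
      then have "hits (x \<circ> Inr) {num_rejected ?h..<num_rejected ?h + v (Suc j)}
          = hits (y \<circ> Inr) {num_rejected ?h..<num_rejected ?h + v (Suc j)}"
        using xy by (intro ext hits_cong) auto
      then show "?P ?h (x \<circ> Inr) = ?P (history_upto f (y \<circ> Inl) (y \<circ> Inr) (j * w)) (y \<circ> Inr)"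
        unfolding h by (simp only:)
    qed
  qed
  have "{\<omega> \<in> space M. MaxLoad n f Z0 Z1 t \<omega> < K} \<subseteq> (\<Union>j<N. ?G j \<union> ?C j)"
  proof (rule subsetI, rule ccontr)
    fix \<omega>
    assume \<omega>: "\<omega> \<in> {\<omega> \<in> space M. MaxLoad n f Z0 Z1 t \<omega> < K}" and not: "\<omega> \<notin> (\<Union>j<N. ?G j \<union> ?C j)"
    define x where "x = (\<lambda>i. case_sum Z0 Z1 i \<omega>)"
    let ?L = "load f (x \<circ> Inl) (x \<circ> Inr)"
    have Max: "MaxLoad n f Z0 Z1 t \<omega> = real (Max (?L ?T ` {1..n}))"
      by (simp add: MaxLoad_def max_load_eq x_def o_def)
    have light: "?L i m < K" if "m \<in> {1..n}" "i \<le> N * w" for i m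
    proof -
      have "?L i m \<le> ?L ?T m" using that T by (intro load_mono) simp
      also have "\<dots> \<le> Max (?L ?T ` {1..n})" using that by (intro Max_ge) auto
      finally show ?thesis using \<omega> Max by simp
    qed
    have "v j \<le> card (?B x j)" if "j \<le> N" for j
      using that
    proof (induction j)
      case 0
      have "?B x 0 = {1..n}" using start(1) by (auto simp: heavy_bins_def)
      then have "card (?B x 0) = n" by (simp only: card_atLeastAtMost diff_Suc_1)
      then show ?case using start(2) by (simp only:)
    next
      case (Suc j)
      then have j: "j < N" by simp
      then have IH: "v j \<le> card (?B x j)" using Suc.IH less_imp_le by blast
      have nG: "\<omega> \<notin> ?G j" and nC: "\<omega> \<notin> ?C j" using not j by auto
      have mem: "\<omega> \<in> event P \<longleftrightarrow> P x" for P using \<omega> by (simp add: event_def x_def)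
      have "real n * hit_prob n w (\<kappa> (Suc j)) / 2 \<le> real (card {m \<in> {1..n}. hits x (?W j) m = \<kappa> (Suc j)})"
        using nG unfolding mem not_less card_atLeastAtMost diff_Suc_1 .
      then have "2 * v (Suc j) \<le> card {m \<in> {1..n}. hits (x \<circ> Inl) {j * w<..Suc j * w} m = \<kappa> (Suc j)}"
        using prim(2)[OF j] unfolding hits_Inl by linarith
      moreover have "\<exists>m\<in>?B x j. s (Suc j) \<le> hits (x \<circ> Inr) {?R x j..<?R x j + v (Suc j)} m"
        using nC IH unfolding mem not_less[symmetric] by blast
      moreover have "j * w \<le> Suc j * w" by simp
      ultimately have "v (Suc j) \<le> card (?B x (Suc j)) \<or> (\<exists>m\<in>{1..n}. \<kappa> j + s (Suc j) \<le> ?L (Suc j * w) m)"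
        using heavy_bins_step[of "j * w" "Suc j * w" "v (Suc j)" n "x \<circ> Inl" "\<kappa> (Suc j)" "v j" f "x \<circ> Inr" "\<kappa> j" "s (Suc j)"]
          IH by blast
      moreover have "?L (Suc j * w) m < \<kappa> j + s (Suc j)" if "m \<in> {1..n}" for m
        using light[OF that, of "Suc j * w"] target(1)[OF j] j by (simp add: Suc_le_eq less_le_trans mult_le_mono1 del: mult_Suc)
      ultimately show ?case using not_less by blast
    qed
    from this[of N] have "card (?B x N) \<noteq> 0" using v1[of N] by simp
    then obtain m where "m \<in> ?B x N" by fastforce
    then have "m \<in> {1..n}" "\<kappa> N \<le> ?L (N * w) m" by (auto simp: heavy_bins_def)
    with light[of m "N * w"] target(2) show False by simp
  qed
  then have "prob {\<omega> \<in> space M. MaxLoad n f Z0 Z1 t \<omega> < K} \<le> prob (\<Union>j<N. ?G j \<union> ?C j)"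
    using Gm Cm by (intro finite_measure_mono) auto
  also have "\<dots> \<le> (\<Sum>j<N. prob (?G j \<union> ?C j))"
    using Gm Cm by (intro finite_measure_subadditive_finite) auto
  also have "\<dots> \<le> (\<Sum>j<N. ?\<alpha> j + ?\<beta> j)"
  proof (rule sum_mono)
    fix j assume "j \<in> {..<N}"
    then have j: "j < N" by simp
    have "prob (?G j \<union> ?C j) \<le> prob (?G j) + prob (?C j)" by (rule measure_Un_le[OF Gm Cm])
    then show "prob (?G j \<union> ?C j) \<le> ?\<alpha> j + ?\<beta> j" using G[OF j] C[OF j] by linarith
  qed
  finally show ?thesis .
qed

end

section \<open>Asymptotics of the threshold and of binomial probabilities\<close>

definition threshold :: "nat \<Rightarrow> real" where
  "threshold n = sqrt (2 * ln (real n) / ln (ln (real n)))"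

text \<open>
  The exponential scale of the problem: the number of bins of load about \<open>a * threshold n\<close> is
  \<open>n * exp (- a * rate n)\<close> up to an error in \<open>a\<close> that tends to \<open>0\<close>.
\<close>

definition rate :: "nat \<Rightarrow> real" where
  "rate n = ln (real n) / threshold n"

lemma threshold_at_top: "filterlim threshold at_top at_top"
  unfolding threshold_def by real_asymp

lemma rate_at_top: "filterlim rate at_top at_top"
  unfolding rate_def threshold_def by real_asymp

lemma rate_over_ln: "(\<lambda>n. rate n / ln (real n)) \<longlonglongrightarrow> 0"
  unfolding rate_def threshold_def by real_asymp

lemma threshold_over_rate: "(\<lambda>n. threshold n / rate n) \<longlonglongrightarrow> 0"
  unfolding rate_def threshold_def by real_asymp

lemma threshold_over_n: "(\<lambda>n. threshold n / real n) \<longlonglongrightarrow> 0"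
  unfolding threshold_def by real_asymp

lemma ln_threshold: "(\<lambda>n. threshold n * ln (threshold n) / rate n) \<longlonglongrightarrow> 1"
proof -
  have "(\<lambda>n::nat. ln (sqrt (2 * ln (real n) / ln (ln (real n)))) / (ln (ln (real n)) / 2)) \<longlonglongrightarrow> 1"
    by real_asymp
  moreover have "\<forall>\<^sub>F n::nat in sequentially. ln (ln (real n)) > 0 \<and> ln (real n) > 0"
    by (intro eventually_conj; real_asymp)
  then have "\<forall>\<^sub>F n in sequentially. ln (sqrt (2 * ln (real n) / ln (ln (real n)))) / (ln (ln (real n)) / 2)
      = threshold n * ln (threshold n) / rate n"
  proof eventually_elim
    case (elim n)
    then have pos: "threshold n > 0" by (simp add: threshold_def)
    have "threshold n * threshold n = 2 * ln (real n) / ln (ln (real n))"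
    proof -
      have "0 \<le> 2 * ln (real n) / ln (ln (real n))" using elim by (intro divide_nonneg_pos) auto
      then show ?thesis by (simp only: threshold_def real_sqrt_mult_self abs_of_nonneg)
    qed
    then have "threshold n / rate n = 2 / ln (ln (real n))"
      using elim pos by (simp add: rate_def field_simps)
    then have "threshold n / rate n * ln (threshold n) = 2 / ln (ln (real n)) * ln (threshold n)" by simp
    then show ?case by (simp add: threshold_def)
  qed
  ultimately show ?thesis by (rule Lim_transform_eventually)
qed

lemma threshold_pos: "\<forall>\<^sub>F n in sequentially. threshold n > 0"
  using threshold_at_top by (simp add: filterlim_at_top_dense)

lemma rate_pos: "\<forall>\<^sub>F n in sequentially. rate n > 0"
  using rate_at_top by (simp add: filterlim_at_top_dense)

lemma threshold_times_rate: "\<forall>\<^sub>F n in sequentially. threshold n * rate n = ln (real n)"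
  using threshold_pos by eventually_elim (simp add: rate_def)

lemma ln_minus_rate_at_top:
  assumes "\<eta> > 0"
  shows "filterlim (\<lambda>n. \<eta> * ln (real n) - c * rate n) at_top sequentially"
proof -
  have "filterlim (\<lambda>n. ln (real n) * (\<eta> - c * (rate n / ln (real n)))) at_top sequentially"
  proof (rule filterlim_at_top_mult_tendsto_pos)
    show "(\<lambda>n. \<eta> - c * (rate n / ln (real n))) \<longlonglongrightarrow> \<eta> - c * 0"
      by (intro tendsto_intros rate_over_ln)
  qed (use assms in \<open>simp, real_asymp\<close>)
  moreover have "\<forall>\<^sub>F n::nat in sequentially. ln (real n) > 0" by real_asymp
  then have "\<forall>\<^sub>F n in sequentially. ln (real n) * (\<eta> - c * (rate n / ln (real n))) = \<eta> * ln (real n) - c * rate n"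
    by eventually_elim (simp add: algebra_simps)
  ultimately show ?thesis by (simp cong: filterlim_cong)
qed

text \<open>By \<open>ln_threshold\<close>, asymptotics relative to \<open>rate\<close> reduce to asymptotics relative to \<open>x * ln x\<close>.\<close>

lemma threshold_entropy_limit:
  assumes "((\<lambda>x::real. g x / (x * ln x)) \<longlongrightarrow> a) at_top"
  shows "(\<lambda>n. g (threshold n) / rate n) \<longlonglongrightarrow> a"
proof -
  have "(\<lambda>n. g (threshold n) / (threshold n * ln (threshold n)) * (threshold n * ln (threshold n) / rate n))
      \<longlonglongrightarrow> a * 1"
    by (intro tendsto_mult ln_threshold filterlim_compose[OF assms threshold_at_top])
  moreover have "\<forall>\<^sub>F n in sequentially. threshold n > 1"
    using threshold_at_top by (simp add: filterlim_at_top_dense)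
  then have "\<forall>\<^sub>F n in sequentially. g (threshold n) / (threshold n * ln (threshold n)) *
      (threshold n * ln (threshold n) / rate n) = g (threshold n) / rate n"
    by eventually_elim simp
  ultimately have "(\<lambda>n. g (threshold n) / rate n) \<longlonglongrightarrow> a * 1"
    by (rule Lim_transform_eventually)
  then show ?thesis by simp
qed

text \<open>
  The main factor of a binomial probability with mean of constant order is \<open>(c / k) ^ k\<close>. This lemma
  and \<open>power_le_exp_rate\<close> locate it on the scale of \<open>rate\<close>, uniformly in \<open>k\<close> so that the
  roundings made later do not matter.
\<close>

lemma power_ge_exp_rate:
  assumes a: "a \<ge> 0" and c: "c > 0" and \<eta>: "\<eta> > 0"
  shows "\<forall>\<^sub>F n in sequentially. \<forall>k::nat. real k \<le> a * threshold n + 1 \<longrightarrow>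
    exp (- (a + \<eta>) * rate n) \<le> (c / real k) ^ k"
proof -
  have "((\<lambda>x::real. (a * x + 1) * ln ((a + 1) * x / c) / (x * ln x)) \<longlongrightarrow> a) at_top"
  proof -
    have "((\<lambda>x::real. (a + 1 / x) * (ln ((a + 1) / c) / ln x + 1)) \<longlongrightarrow> (a + 0) * (0 + 1)) at_top"
      by (intro tendsto_intros; real_asymp)
    moreover have "\<forall>\<^sub>F x::real in at_top. (a + 1 / x) * (ln ((a + 1) / c) / ln x + 1)
        = (a * x + 1) * ln ((a + 1) * x / c) / (x * ln x)"
      using eventually_gt_at_top[of 1]
    proof eventually_elim
      case (elim x)
      have "ln ((a + 1) * x / c) = ln ((a + 1) / c * x)" by simp
      also have "\<dots> = ln ((a + 1) / c) + ln x" using a c elim by (subst ln_mult) auto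
      finally show ?case using elim by (simp add: field_simps)
    qed
    ultimately show ?thesis by (simp add: tendsto_cong)
  qed
  from threshold_entropy_limit[OF this]
  have "\<forall>\<^sub>F n in sequentially. (a * threshold n + 1) * ln ((a + 1) * threshold n / c) / rate n < a + \<eta>"
    using \<eta> by (intro order_tendstoD(2)) auto
  moreover have "\<forall>\<^sub>F n in sequentially. threshold n > max 1 (c / (a + 1))"
    using threshold_at_top by (simp only: filterlim_at_top_dense)
  ultimately show ?thesis using rate_pos
  proof eventually_elim
    case (elim n)
    show ?case
    proof (intro allI impI)
      fix k :: nat
      assume k: "real k \<le> a * threshold n + 1"
      show "exp (- (a + \<eta>) * rate n) \<le> (c / real k) ^ k"
      proof (cases "k = 0")
        case True
        have "0 \<le> (a + \<eta>) * rate n" using a \<eta> elim by simp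
        then show ?thesis using True by (simp add: algebra_simps)
      next
        case False
        have l: "threshold n > 1" "(a + 1) * threshold n / c > 1"
          using elim a c by (auto simp: field_simps)
        have "real k \<le> (a + 1) * threshold n" using k l(1) by (simp add: algebra_simps)
        then have "ln (real k / c) \<le> ln ((a + 1) * threshold n / c)"
          using False c by (subst ln_le_cancel_iff) (auto simp: divide_right_mono field_simps)
        then have "real k * ln (real k / c) \<le> real k * ln ((a + 1) * threshold n / c)"
          by (intro mult_left_mono) auto
        also have "\<dots> \<le> (a * threshold n + 1) * ln ((a + 1) * threshold n / c)"
          using k l by (intro mult_right_mono ln_ge_zero) auto
        also have "\<dots> \<le> (a + \<eta>) * rate n" using elim by (simp add: field_simps)
        finally have "exp (- (a + \<eta>) * rate n) \<le> exp (- (real k * ln (real k / c)))"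
          unfolding exp_le_cancel_iff by linarith
        also have "\<dots> = exp (real k * ln (c / real k))" using False c by (simp add: ln_div algebra_simps)
        also have "\<dots> = (c / real k) ^ k" using False c by (simp add: exp_of_nat_mult)
        finally show ?thesis .
      qed
    qed
  qed
qed

text \<open>A single term of the exponential series of \<open>k\<close> is at most its sum \<open>exp k\<close>.\<close>

lemma fact_ge_power_div_exp: "(real k / exp 1) ^ k \<le> fact k"
proof -
  have "real k ^ k / fact k \<le> (\<Sum>i. real k ^ i / fact i)"
    using sum_le_suminf[of "\<lambda>i. real k ^ i / fact i" "{k}"] summable_exp_generic[of "real k"]
    by (simp add: divide_inverse mult.commute)
  also have "\<dots> = exp (real k)" by (simp add: exp_def divide_inverse mult.commute)
  also have "\<dots> = exp 1 ^ k" by (simp add: exp_of_nat_mult[symmetric])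
  finally show ?thesis by (simp add: power_divide field_simps)
qed

lemma power_le_exp_rate:
  assumes c: "c > 0" and \<eta>: "\<eta> > 0"
  shows "\<forall>\<^sub>F n in sequentially. \<forall>k::nat. threshold n - 1 \<le> real k \<longrightarrow>
    (c / real k) ^ k \<le> exp (- (1 - \<eta>) * rate n)"
proof -
  have "((\<lambda>x::real. (x - 1) * ln ((x - 1) / c) / (x * ln x)) \<longlongrightarrow> 1) at_top"
    using c by real_asymp
  from threshold_entropy_limit[OF this]
  have "\<forall>\<^sub>F n in sequentially. (threshold n - 1) * ln ((threshold n - 1) / c) / rate n > 1 - \<eta>"
    using \<eta> by (intro order_tendstoD(1)) auto
  moreover have "\<forall>\<^sub>F n in sequentially. threshold n > c + 1"
    using threshold_at_top by (simp only: filterlim_at_top_dense)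
  ultimately show ?thesis using rate_pos
  proof eventually_elim
    case (elim n)
    show ?case
    proof (intro allI impI)
      fix k :: nat
      assume k: "threshold n - 1 \<le> real k"
      have pos: "threshold n - 1 > c" "real k > 0" using elim k c by auto
      have "(1 - \<eta>) * rate n \<le> (threshold n - 1) * ln ((threshold n - 1) / c)"
        using elim by (simp add: field_simps)
      also have "\<dots> \<le> real k * ln (real k / c)"
        using pos k c by (intro mult_mono) (auto simp: divide_right_mono)
      finally have "exp (- (real k * ln (real k / c))) \<le> exp (- (1 - \<eta>) * rate n)"
        unfolding exp_le_cancel_iff by linarith
      moreover have "exp (- (real k * ln (real k / c))) = exp (real k * ln (c / real k))"
        using pos c by (simp add: ln_div algebra_simps)
      moreover have "\<dots> = (c / real k) ^ k" using pos c by (simp add: exp_of_nat_mult)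
      ultimately show "(c / real k) ^ k \<le> exp (- (1 - \<eta>) * rate n)" by simp
    qed
  qed
qed

lemma hit_prob_ge:
  assumes n: "n \<ge> 2" and k: "k \<le> w" and w: "real w \<le> C * real n" 
  shows "exp (- 2 * C) * (real w / (real n * real k)) ^ k \<le> hit_prob n w k"
proof -
  have "exp (- 2 * C) \<le> exp (- 2 * real w / real n)"
    using w n by (simp add: field_simps)
  also have "\<dots> = exp (- 2 / real n) ^ w" by (simp add: exp_of_nat_mult[symmetric])
  also have "\<dots> \<le> (1 - 1 / real n) ^ w"
  proof (rule power_mono)
    have "1 + 2 / real n \<le> exp (2 / real n)" by (rule exp_ge_add_one_self)
    then have "exp (- 2 / real n) \<le> 1 / (1 + 2 / real n)"
      using n by (simp add: exp_minus inverse_eq_divide frac_le add_pos_nonneg)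
    also have "\<dots> \<le> 1 - 1 / real n" using n by (simp add: field_simps)
    finally show "exp (- 2 / real n) \<le> 1 - 1 / real n" .
  qed simp
  also have "\<dots> \<le> (1 - 1 / real n) ^ (w - k)"
    using n by (intro power_decreasing) auto
  finally have "exp (- 2 * C) \<le> (1 - 1 / real n) ^ (w - k)" .
  moreover have "(real w / real k) ^ k * (1 / real n) ^ k \<le> real (w choose k) * (1 / real n) ^ k"
    by (intro mult_right_mono binomial_ge_n_over_k_pow_k k) simp
  then have "(real w / (real n * real k)) ^ k \<le> real (w choose k) * (1 / real n) ^ k"
    by (simp add: power_mult_distrib[symmetric] mult.commute)
  ultimately have "exp (- 2 * C) * (real w / (real n * real k)) ^ k
      \<le> (1 - 1 / real n) ^ (w - k) * (real (w choose k) * (1 / real n) ^ k)"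
    using n by (intro mult_mono) auto
  then show ?thesis by (simp add: hit_prob_def mult_ac)
qed

text \<open>
  The error term that the pairwise correlations of bins contribute to Chebyshev's inequality vanishes, because
  \<open>(1 - 1 / n) ^ (2 * \<kappa> n) \<ge> 1 - 2 * \<kappa> n / n\<close> and \<open>\<kappa> n\<close> is much smaller than \<open>n\<close>.
\<close>

lemma correlation_factor_limit:
  assumes \<kappa>: "\<forall>\<^sub>F n in sequentially. real (\<kappa> n) \<le> a * threshold n + 1"
  shows "(\<lambda>n. 4 * (1 / (1 - 1 / real n) ^ (2 * \<kappa> n) - 1)) \<longlonglongrightarrow> 0"
proof (rule tendsto_sandwich[where f = "\<lambda>_. 0"
      and h = "\<lambda>n. 4 * (1 / (1 - 2 * (a * threshold n + 1) / real n) - 1)"])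
  have lim: "(\<lambda>n. 2 * (a * threshold n + 1) / real n) \<longlonglongrightarrow> 0"
  proof -
    have "(\<lambda>n. 2 * (a * (threshold n / real n) + 1 / real n)) \<longlonglongrightarrow> 2 * (a * 0 + 0)"
      by (intro tendsto_intros threshold_over_n)
    then show ?thesis by (simp add: field_simps add_divide_distrib)
  qed
  then have "(\<lambda>n. 4 * (1 / (1 - 2 * (a * threshold n + 1) / real n) - 1)) \<longlonglongrightarrow> 4 * (1 / (1 - 0) - 1)"
    by (intro tendsto_intros) auto
  then show "(\<lambda>n. 4 * (1 / (1 - 2 * (a * threshold n + 1) / real n) - 1)) \<longlonglongrightarrow> 0" by simp
  have small: "\<forall>\<^sub>F n in sequentially. 2 * (a * threshold n + 1) / real n < 1"
    using lim by (intro order_tendstoD(2)) auto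
  have big: "\<forall>\<^sub>F n::nat in sequentially. n \<ge> 2" by (rule eventually_ge_at_top)
  show "\<forall>\<^sub>F n in sequentially. 4 * (1 / (1 - 1 / real n) ^ (2 * \<kappa> n) - 1)
      \<le> 4 * (1 / (1 - 2 * (a * threshold n + 1) / real n) - 1)"
    using small big \<kappa>
  proof eventually_elim
    case (elim n)
    have "1 - 2 * (a * threshold n + 1) / real n \<le> 1 - real (2 * \<kappa> n) / real n"
      using elim by (simp add: divide_right_mono)
    also have "\<dots> \<le> (1 - 1 / real n) ^ (2 * \<kappa> n)"
      using Bernoulli_inequality[of "- (1 / real n)" "2 * \<kappa> n"] elim by simp
    finally have "1 / (1 - 1 / real n) ^ (2 * \<kappa> n) \<le> 1 / (1 - 2 * (a * threshold n + 1) / real n)"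
      using elim by (intro divide_left_mono mult_pos_pos) auto
    then show ?case by simp
  qed
  show "\<forall>\<^sub>F n in sequentially. 0 \<le> 4 * (1 / (1 - 1 / real n) ^ (2 * \<kappa> n) - 1)"
    using big
  proof eventually_elim
    case (elim n)
    then have "(1 - 1 / real n) ^ (2 * \<kappa> n) \<le> 1" "(1 - 1 / real n) ^ (2 * \<kappa> n) > 0"
      by (auto intro!: power_le_one)
    then have "1 \<le> 1 / (1 - 1 / real n) ^ (2 * \<kappa> n)" by (simp only: le_divide_eq_1_pos)
    then show ?case by simp
  qed
qed simp

lemma four_over_tendsto_0:
  assumes "filterlim F at_top sequentially" "\<forall>\<^sub>F n in sequentially. exp (F n) \<le> Y n"
  shows "(\<lambda>n. 4 / Y n :: real) \<longlonglongrightarrow> 0"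
proof -
  have "filterlim (\<lambda>n. exp (F n)) at_top sequentially"
    by (rule filterlim_compose[OF exp_at_top assms(1)])
  then have "filterlim Y at_top sequentially" using assms(2) by (rule filterlim_at_top_mono)
  then show ?thesis by (intro tendsto_divide_0[OF tendsto_const] filterlim_at_top_imp_at_infinity)
qed

lemma measure_tendsto_0:
  assumes "\<forall>\<^sub>F n in sequentially. measure (M n) (E n) \<le> b n" "b \<longlonglongrightarrow> 0"
  shows "(\<lambda>n. measure (M n) (E n)) \<longlonglongrightarrow> 0"
  by (rule tendsto_sandwich[OF _ assms(1) tendsto_const assms(2)]) simp

lemma threshold_le_rate: "\<forall>\<^sub>F n in sequentially. threshold n \<le> rate n"
proof -
  have "\<forall>\<^sub>F n in sequentially. threshold n / rate n < 1"
    using threshold_over_rate by (rule order_tendstoD(2)) simp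
  then show ?thesis using rate_pos by eventually_elim (simp add: field_simps)
qed

text \<open>
  If at least \<open>c n exp (- b r)\<close> balls are thrown, where \<open>r\<close> is the rate, then a bin gets about \<open>a\<close> times the
  threshold of them with probability at least about \<open>(exp (- b r))\<close> to that power, times \<open>exp (- a r)\<close>
  for the factorial. Since the product of threshold and rate is \<open>ln n\<close>, the former is \<open>exp (- a b ln n)\<close>.
  The terms \<open>b\<close> and \<open>\<eta>\<close> next to \<open>a\<close> absorb the rounding of \<open>\<kappa> n\<close> and the constant factors.
\<close>

lemma hit_prob_asymp_ge:
  fixes w \<kappa> :: "nat \<Rightarrow> nat"
  assumes a: "a \<ge> 0" and b: "b \<ge> 0" and c: "c > 0" and \<eta>: "\<eta> > 0"
    and w: "\<forall>\<^sub>F n in sequentially. c * real n * exp (- b * rate n) \<le> real (w n)"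
      "\<forall>\<^sub>F n in sequentially. real (w n) \<le> C * real n"
    and \<kappa>: "\<forall>\<^sub>F n in sequentially. real (\<kappa> n) \<le> a * threshold n + 1"
  shows "\<forall>\<^sub>F n in sequentially. \<kappa> n \<le> w n \<and>
    exp (- (a * b * ln (real n)) - (a + b + \<eta>) * rate n) \<le> hit_prob n (w n) (\<kappa> n)"
proof -
  have "\<forall>\<^sub>F n in sequentially. 1 * ln (real n) - (b + 1) * rate n \<ge> ln ((a + 1) / c)"
    using ln_minus_rate_at_top[of 1 "b + 1"] by (simp add: filterlim_at_top)
  moreover have "\<forall>\<^sub>F n in sequentially. rate n \<ge> max 1 (2 * C * 2 / \<eta>)"
    using rate_at_top by (simp only: filterlim_at_top)
  moreover have "\<forall>\<^sub>F n in sequentially. \<forall>k::nat. real k \<le> a * threshold n + 1 \<longrightarrow>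
      exp (- (a + \<eta> / 2) * rate n) \<le> (c / real k) ^ k"
    using a c \<eta> by (intro power_ge_exp_rate) auto
  moreover have "\<forall>\<^sub>F n::nat in sequentially. n \<ge> 2" by (rule eventually_ge_at_top)
  ultimately show ?thesis using w \<kappa> threshold_le_rate threshold_times_rate
  proof eventually_elim
    case (elim n)
    have n: "n \<ge> 2" "real n = exp (ln (real n))" using elim by auto
    have "real (\<kappa> n) \<le> a * threshold n + 1" using elim by simp
    also have "\<dots> \<le> a * rate n + rate n" using elim a by (intro add_mono mult_left_mono) auto
    also have "\<dots> = (a + 1) * rate n" by (simp add: algebra_simps)
    also have "\<dots> \<le> (a + 1) * exp (rate n)"
    proof (rule mult_left_mono)
      show "rate n \<le> exp (rate n)" using exp_ge_add_one_self[of "rate n"] by linarith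
    qed (use a in simp)
    also have "\<dots> = c * exp (ln ((a + 1) / c) + rate n)"
      using a c by (simp add: exp_add)
    also have "\<dots> \<le> c * exp (ln (real n) - b * rate n)"
      using elim c by (simp add: algebra_simps)
    also have "\<dots> = c * real n * exp (- b * rate n)"
      using n by (simp add: exp_diff exp_minus divide_inverse)
    also have "\<dots> \<le> real (w n)" using elim by simp
    finally have le: "\<kappa> n \<le> w n" by simp
    have "exp (- (a * b * ln (real n)) - (a + b + \<eta>) * rate n)
        = exp (- (\<eta> / 2 * rate n)) * (exp (- (b * rate n * (a * threshold n + 1))) * exp (- (a + \<eta> / 2) * rate n))"
    proof -
      have "a * b * ln (real n) = a * b * (threshold n * rate n)"
        by (simp only: elim(9))
      show ?thesis
        unfolding \<open>a * b * ln (real n) = a * b * (threshold n * rate n)\<close> exp_add[symmetric]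
        by (rule arg_cong[where f = exp]) (simp add: algebra_simps)
    qed
    also have "\<dots> \<le> exp (- 2 * C) * (exp (- (b * rate n * real (\<kappa> n))) * (c / real (\<kappa> n)) ^ \<kappa> n)"
    proof (intro mult_mono)
      have "2 * C * 2 / \<eta> \<le> rate n" using elim by simp
      then show "exp (- (\<eta> / 2 * rate n)) \<le> exp (- 2 * C)" using \<eta> by (simp add: field_simps)
      show "exp (- (b * rate n * (a * threshold n + 1))) \<le> exp (- (b * rate n * real (\<kappa> n)))"
        using elim b by (simp add: mult_left_mono)
      show "exp (- (a + \<eta> / 2) * rate n) \<le> (c / real (\<kappa> n)) ^ \<kappa> n" using elim by blast
    qed auto
    also have "exp (- (b * rate n * real (\<kappa> n))) * (c / real (\<kappa> n)) ^ \<kappa> n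
        = (c * exp (- b * rate n) / real (\<kappa> n)) ^ \<kappa> n"
      by (simp add: power_mult_distrib power_divide exp_of_nat_mult[symmetric] mult_ac)
    also have "exp (- 2 * C) * \<dots> \<le> exp (- 2 * C) * (real (w n) / (real n * real (\<kappa> n))) ^ \<kappa> n"
    proof (intro mult_left_mono power_mono)
      have "c * exp (- b * rate n) \<le> real (w n) / real n" using elim by (simp add: field_simps)
      then have "c * exp (- b * rate n) / real (\<kappa> n) \<le> real (w n) / real n / real (\<kappa> n)"
        by (rule divide_right_mono) simp
      then show "c * exp (- b * rate n) / real (\<kappa> n) \<le> real (w n) / (real n * real (\<kappa> n))" by simp
    qed (use c in auto)
    also have "\<dots> \<le> hit_prob n (w n) (\<kappa> n)"
      using elim by (intro hit_prob_ge n(1) le) simp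
    finally show ?case using le by simp
  qed
qed

lemma of_nat_nat_ceiling_bounds:
  fixes x :: real
  assumes "x \<ge> 0"
  shows "x \<le> real (nat \<lceil>x\<rceil>)" "real (nat \<lceil>x\<rceil>) \<le> x + 1"
  using assms by linarith+

section \<open>Asymptotic bounds for the maximal load\<close>

theorem MaxLoad_ge_asymp:
  fixes \<rho> :: real and M :: "nat \<Rightarrow> 'a measure" and Z0 Z1 :: "nat \<Rightarrow> nat \<Rightarrow> 'a \<Rightarrow> nat"
    and g :: "nat \<Rightarrow> strategy"
  assumes \<rho>: "\<rho> > 0" and src: "\<And>n. n \<ge> 3 \<Longrightarrow> two_thinning_source (M n) n (Z0 n) (Z1 n)"
    and d: "d > 0"
  shows "(\<lambda>n. measure (M n) {\<omega> \<in> space (M n).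
    MaxLoad n (g n) (Z0 n) (Z1 n) (\<rho> * real n) \<omega> < (2 - d) * threshold n}) \<longlonglongrightarrow> 0"
proof -
  define e where "e = min (d / 4) (1 / 2)"
  have e: "0 < e" "e < 1" "2 - d \<le> 2 - 4 * e" using d by (auto simp: e_def)
  define N where "N = nat \<lceil>2 / e\<rceil>"
  have N: "2 / e \<le> real N" using e of_nat_nat_ceiling_bounds[of "2 / e"] by (simp add: N_def)
  then have N0: "real N > 0" using e by (meson divide_pos_pos less_le_trans zero_less_numeral)
  \<comment> \<open>The load \<open>\<kappa> n j\<close> and the number \<open>v n j\<close> of bins belong to the invariant before phase \<open>j\<close>; \<open>nat\<close> turns the
    negative value for \<open>j = 0\<close> into \<open>0\<close>. The lag of one in \<open>\<kappa>\<close> leaves a factor \<open>exp (e * rate n)\<close> between the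
    number of bins that receive \<open>\<kappa> n (Suc j)\<close> balls in a phase and the number \<open>v n (Suc j)\<close> that is needed.
    The value \<open>b i\<close> is \<open>1 - e\<close> times the largest load, in units of the threshold, to which \<open>v n i\<close> uniform
    balls can raise a bin.\<close>
  define \<kappa> where "\<kappa> n j = nat \<lceil>(real j - 1) * e * threshold n\<rceil>" for n j
  define v where "v n j = nat \<lceil>real n * exp (- (real j * e) * rate n)\<rceil>" for n j
  define b where "b i = (1 - e) / (real i * e)" for i
  define s where "s n i = nat \<lceil>b i * threshold n\<rceil>" for n i
  define w where "w n = nat \<lfloor>\<rho> * real n\<rfloor> div N" for n
  define K where "K n = nat \<lceil>(2 - 4 * e) * threshold n\<rceil>" for n
  have b: "b i \<ge> 0" for i using e by (simp add: b_def)
  have \<kappa>_le: "\<forall>\<^sub>F n in sequentially. real (\<kappa> n (Suc j)) \<le> real j * e * threshold n + 1" for j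
    using threshold_pos
  proof eventually_elim
    case (elim n)
    then show ?case
      using e of_nat_nat_ceiling_bounds(2)[of "real j * e * threshold n"] by (simp add: \<kappa>_def)
  qed
  have s_le: "\<forall>\<^sub>F n in sequentially. real (s n i) \<le> b i * threshold n + 1" for i
    using threshold_pos
  proof eventually_elim
    case (elim n)
    then show ?case using b of_nat_nat_ceiling_bounds(2)[of "b i * threshold n"] by (simp add: s_def)
  qed
  have v_ge: "real n * exp (- (real j * e) * rate n) \<le> real (v n j)" for n j
    unfolding v_def by (intro of_nat_nat_ceiling_bounds(1)) simp
  have v_le: "\<forall>\<^sub>F n in sequentially. real (v n j) \<le> 2 * (real n * exp (- (real j * e) * rate n))" for j
  proof -
    have "\<forall>\<^sub>F n in sequentially. 1 * ln (real n) - (real j * e) * rate n \<ge> 0"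
      using ln_minus_rate_at_top[of 1 "real j * e"] by (simp only: filterlim_at_top zero_less_one simp_thms)
    moreover have "\<forall>\<^sub>F n::nat in sequentially. n > 0" by (rule eventually_gt_at_top)
    ultimately show ?thesis
    proof eventually_elim
      case (elim n)
      have "1 \<le> exp (ln (real n) - real j * e * rate n)" using elim by simp
      also have "\<dots> = real n * exp (- (real j * e) * rate n)"
        using elim by (simp add: exp_diff exp_minus divide_inverse)
      finally have "1 \<le> real n * exp (- (real j * e) * rate n)" .
      moreover have "real (v n j) \<le> real n * exp (- (real j * e) * rate n) + 1"
        unfolding v_def by (rule of_nat_nat_ceiling_bounds(2)) simp
      ultimately show ?case by linarith
    qed
  qed
  have v_le_n: "\<forall>\<^sub>F n in sequentially. real (v n j) \<le> 1 * real n" for j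
    using rate_pos
  proof eventually_elim
    case (elim n)
    then have "real n * exp (- (real j * e) * rate n) \<le> real n * 1"
      using e by (intro mult_left_mono) auto
    then have "v n j \<le> nat \<lceil>real n\<rceil>" unfolding v_def by (intro nat_mono ceiling_mono) simp
    then show ?case by simp
  qed
  have w_ge: "\<forall>\<^sub>F n in sequentially. \<rho> / (2 * real N) * real n * exp (- 0 * rate n) \<le> real (w n)"
  proof -
    have "\<forall>\<^sub>F n::nat in sequentially. real n \<ge> 2 * (1 + real N) / \<rho>"
      using filterlim_real_sequentially by (simp add: filterlim_at_top)
    then show ?thesis
    proof eventually_elim
      case (elim n)
      let ?T = "nat \<lfloor>\<rho> * real n\<rfloor>"
      have "?T = N * w n + ?T mod N" unfolding w_def by simp
      also have "\<dots> \<le> N * w n + N" using N0 by (intro add_left_mono less_imp_le mod_less_divisor) simp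
      finally have "real ?T \<le> real N * real (w n) + real N"
        by (metis of_nat_add of_nat_le_iff of_nat_mult)
      moreover have "\<rho> * real n - 1 \<le> real ?T" by linarith
      ultimately have "\<rho> * real n - 1 \<le> real N * real (w n) + real N" by (rule order_trans[rotated])
      moreover have "2 * (1 + real N) \<le> \<rho> * real n" using elim \<rho> by (simp add: field_simps)
      moreover have "x / 2 \<le> y" if "x - 1 \<le> y + z" "2 * (1 + z) \<le> x" for x y z :: real
        using that by (simp add: field_simps)
      ultimately have "\<rho> * real n / 2 \<le> real N * real (w n)" by blast
      then show ?case using N0 by (simp add: field_simps)
    qed
  qed
  have w_le: "\<forall>\<^sub>F n in sequentially. real (w n) \<le> \<rho> * real n"
  proof (rule always_eventually, rule allI)
    fix n
    have "w n \<le> nat \<lfloor>\<rho> * real n\<rfloor>" unfolding w_def by (rule div_le_dividend)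
    moreover have "real (nat \<lfloor>\<rho> * real n\<rfloor>) \<le> \<rho> * real n" using \<rho> by simp
    ultimately show "real (w n) \<le> \<rho> * real n" by linarith
  qed
  have prim: "\<forall>\<^sub>F n in sequentially. \<kappa> n (Suc j) \<le> w n \<and>
      exp (- (real j * e + e / 2) * rate n) \<le> hit_prob n (w n) (\<kappa> n (Suc j))" for j
    using hit_prob_asymp_ge[OF _ order_refl _ _ w_ge w_le \<kappa>_le, of j "e / 2"] e \<rho> N0
    by (simp add: algebra_simps)
  have sec: "\<forall>\<^sub>F n in sequentially. s n (Suc j) \<le> v n (Suc j) \<and>
      exp (- ((1 - e) * ln (real n)) - (b (Suc j) + real (Suc j) * e + 1) * rate n)
        \<le> hit_prob n (v n (Suc j)) (s n (Suc j))" for j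
  proof -
    have be: "b (Suc j) * (real (Suc j) * e) = 1 - e" using e by (simp add: b_def)
    show ?thesis
      using hit_prob_asymp_ge[OF b _ _ _ _ v_le_n s_le, of "real (Suc j) * e" 1 1 "Suc j" "Suc j"] e v_ge[of _ "Suc j"]
      unfolding be by simp
  qed
  define bound where "bound n j =
      4 / (real n * hit_prob n (w n) (\<kappa> n (Suc j))) + 4 * (1 / (1 - 1 / real n) ^ (2 * \<kappa> n (Suc j)) - 1)
    + (4 / (real (v n j) * hit_prob n (v n (Suc j)) (s n (Suc j)))
       + 4 * (1 / (1 - 1 / real n) ^ (2 * s n (Suc j)) - 1))" for n j
  have bound: "(\<lambda>n. bound n j) \<longlonglongrightarrow> 0" for j
  proof -
    have n0: "\<forall>\<^sub>F n::nat in sequentially. n > 0" by (rule eventually_gt_at_top)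
    have 1: "(\<lambda>n. 4 / (real n * hit_prob n (w n) (\<kappa> n (Suc j)))) \<longlonglongrightarrow> 0"
    proof (rule four_over_tendsto_0[OF ln_minus_rate_at_top[of 1 "real j * e + e / 2"]])
      show "\<forall>\<^sub>F n in sequentially. exp (1 * ln (real n) - (real j * e + e / 2) * rate n)
          \<le> real n * hit_prob n (w n) (\<kappa> n (Suc j))"
        using prim[of j] n0
      proof eventually_elim
        case (elim n)
        have "exp (1 * ln (real n) - (real j * e + e / 2) * rate n)
            = exp (ln (real n)) * exp (- (real j * e + e / 2) * rate n)"
          unfolding exp_add[symmetric] by (rule arg_cong[where f = exp]) (simp add: algebra_simps)
        also have "\<dots> = real n * exp (- (real j * e + e / 2) * rate n)"
          using elim(2) by simp
        finally show ?case using elim by (simp add: mult_left_mono)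
      qed
    qed simp
    have 2: "(\<lambda>n. 4 / (real (v n j) * hit_prob n (v n (Suc j)) (s n (Suc j)))) \<longlonglongrightarrow> 0"
    proof (rule four_over_tendsto_0[OF ln_minus_rate_at_top[OF e(1), of "real j * e + (b (Suc j) + real (Suc j) * e + 1)"]])
      show "\<forall>\<^sub>F n in sequentially. exp (e * ln (real n) - (real j * e + (b (Suc j) + real (Suc j) * e + 1)) * rate n)
          \<le> real (v n j) * hit_prob n (v n (Suc j)) (s n (Suc j))"
        using sec[of j] n0
      proof eventually_elim
        case (elim n)
        have "exp (e * ln (real n) - (real j * e + (b (Suc j) + real (Suc j) * e + 1)) * rate n)
            = exp (ln (real n)) * exp (- (real j * e) * rate n) *
              exp (- ((1 - e) * ln (real n)) - (b (Suc j) + real (Suc j) * e + 1) * rate n)"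
          unfolding exp_add[symmetric] by (rule arg_cong[where f = exp]) (simp add: algebra_simps)
        also have "\<dots> = real n * exp (- (real j * e) * rate n) *
              exp (- ((1 - e) * ln (real n)) - (b (Suc j) + real (Suc j) * e + 1) * rate n)"
          using elim by simp
        also have "\<dots> \<le> real (v n j) * hit_prob n (v n (Suc j)) (s n (Suc j))"
          using elim by (intro mult_mono v_ge) auto
        finally show ?case .
      qed
    qed
    show ?thesis
      unfolding bound_def
      by (rule tendsto_eq_rhs[OF tendsto_add[OF tendsto_add[OF 1 correlation_factor_limit[OF \<kappa>_le]]
            tendsto_add[OF 2 correlation_factor_limit[OF s_le]]]]) simp
  qed
  have le: "\<forall>\<^sub>F n in sequentially. measure (M n) {\<omega> \<in> space (M n).
      MaxLoad n (g n) (Z0 n) (Z1 n) (\<rho> * real n) \<omega> < (2 - d) * threshold n} \<le> (\<Sum>j<N. bound n j)"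
  proof -
    have "\<forall>\<^sub>F n in sequentially. 2 * real (v n (Suc j)) \<le> real n * hit_prob n (w n) (\<kappa> n (Suc j)) / 2" for j
    proof -
      have "\<forall>\<^sub>F n in sequentially. rate n \<ge> ln 8 / (e / 2)"
        using rate_at_top by (simp only: filterlim_at_top)
      then show ?thesis using prim[of j] v_le[of "Suc j"]
      proof eventually_elim
        case (elim n)
        have "ln 8 \<le> e / 2 * rate n" using elim(1) e by (simp add: field_simps)
        then have "8 \<le> exp (e / 2 * rate n)" by (metis exp_le_cancel_iff exp_ln zero_less_numeral)
        then have "8 * exp (- (real (Suc j) * e) * rate n) \<le> exp (e / 2 * rate n) * exp (- (real (Suc j) * e) * rate n)"
          by (intro mult_right_mono) auto
        also have "\<dots> = exp (- (real j * e + e / 2) * rate n)"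
          unfolding exp_add[symmetric] by (rule arg_cong[where f = exp]) (simp add: algebra_simps)
        also have "\<dots> \<le> hit_prob n (w n) (\<kappa> n (Suc j))" using elim by simp
        finally have "real n * (8 * exp (- (real (Suc j) * e) * rate n)) \<le> real n * hit_prob n (w n) (\<kappa> n (Suc j))"
          by (intro mult_left_mono) auto
        then show ?case using elim(3) by linarith
      qed
    qed
    then have "\<forall>\<^sub>F n in sequentially. \<forall>j\<in>{..<N}. 2 * real (v n (Suc j)) \<le> real n * hit_prob n (w n) (\<kappa> n (Suc j)) / 2"
      by (intro eventually_ball_finite) auto
    moreover have "\<forall>\<^sub>F n in sequentially. \<forall>j\<in>{..<N}. \<kappa> n (Suc j) \<le> w n"
    proof (intro eventually_ball_finite finite_lessThan ballI)
      show "\<forall>\<^sub>F n in sequentially. \<kappa> n (Suc j) \<le> w n" for j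
        using prim[of j] by eventually_elim simp
    qed
    moreover have "\<forall>\<^sub>F n in sequentially. \<forall>j\<in>{..<N}. s n (Suc j) \<le> v n (Suc j)"
    proof (intro eventually_ball_finite finite_lessThan ballI)
      show "\<forall>\<^sub>F n in sequentially. s n (Suc j) \<le> v n (Suc j)" for j
        using sec[of j] by eventually_elim simp
    qed
    moreover have "\<forall>\<^sub>F n::nat in sequentially. n \<ge> 3" by (rule eventually_ge_at_top)
    ultimately show ?thesis using threshold_pos
    proof eventually_elim
      case (elim n)
      interpret two_thinning_source "M n" n "Z0 n" "Z1 n" using elim by (intro src) simp
      let ?l = "threshold n"
      have "{\<omega> \<in> space (M n). MaxLoad n (g n) (Z0 n) (Z1 n) (\<rho> * real n) \<omega> < (2 - d) * ?l}
          \<subseteq> {\<omega> \<in> space (M n). MaxLoad n (g n) (Z0 n) (Z1 n) (\<rho> * real n) \<omega> < K n}"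
      proof -
        have "(2 - d) * ?l \<le> (2 - 4 * e) * ?l" using e elim by (intro mult_right_mono) auto
        also have "\<dots> \<le> real (K n)" unfolding K_def by linarith
        finally show ?thesis by auto
      qed
      then have "prob {\<omega> \<in> space (M n). MaxLoad n (g n) (Z0 n) (Z1 n) (\<rho> * real n) \<omega> < (2 - d) * ?l}
          \<le> prob {\<omega> \<in> space (M n). MaxLoad n (g n) (Z0 n) (Z1 n) (\<rho> * real n) \<omega> < K n}"
        by (rule finite_measure_mono) (rule MaxLoad_event_measurable)
      also have "\<dots> \<le> (\<Sum>j<N. bound n j)"
        unfolding bound_def
      proof (rule prob_MaxLoad_less_le)
        show "n \<ge> 2" using elim by simp
        show "N * w n \<le> nat \<lfloor>\<rho> * real n\<rfloor>" unfolding w_def by simp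
        show "\<kappa> n 0 = 0"
          using e elim by (simp add: \<kappa>_def)
        show "v n 0 \<le> n" by (simp add: v_def)
        show "1 \<le> v n j" for j
        proof -
          have "0 < real n * exp (- (real j * e) * rate n)" using elim by simp
          then have "0 < real (v n j)" using v_ge[of n j] by linarith
          then show ?thesis by simp
        qed
        show "K n \<le> \<kappa> n j + s n (Suc j)" for j
        proof -
          \<comment> \<open>The smallest value of \<open>x + (1 - e) / x\<close> is \<open>2 * sqrt (1 - e)\<close>, which is at least \<open>2 - 2 * e\<close>.\<close>
          define x where "x = real (Suc j) * e"
          have x: "x > 0" using e by (simp add: x_def)
          have "0 \<le> (x - (1 - e))\<^sup>2 + (1 - e) * e" using e by (intro add_nonneg_nonneg) auto
          then have "2 * (1 - e) * x \<le> x * x + (1 - e)"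
            by (simp add: power2_eq_square algebra_simps)
          then have "2 - 2 * e \<le> x + (1 - e) / x" using x by (simp add: field_simps)
          moreover have "(real j - 1) * e = x - 2 * e" by (simp add: x_def algebra_simps)
          moreover have "b (Suc j) = (1 - e) / x" by (simp add: b_def x_def)
          ultimately have "2 - 4 * e \<le> (real j - 1) * e + b (Suc j)" by linarith
          then have "(2 - 4 * e) * ?l \<le> ((real j - 1) * e + b (Suc j)) * ?l"
            using elim by (intro mult_right_mono) auto
          also have "\<dots> = (real j - 1) * e * ?l + b (Suc j) * ?l" by (simp add: algebra_simps)
          also have "\<dots> \<le> real (\<kappa> n j) + real (s n (Suc j))"
            unfolding \<kappa>_def s_def by (intro add_mono) linarith+
          finally show ?thesis unfolding K_def by linarith
        qed
        show "K n \<le> \<kappa> n N"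
        proof -
          have "2 \<le> real N * e" using N e by (simp add: field_simps)
          then have "2 - 4 * e \<le> (real N - 1) * e" using e by (simp add: algebra_simps)
          then have "(2 - 4 * e) * ?l \<le> (real N - 1) * e * ?l"
            using elim by (intro mult_right_mono) auto
          then show ?thesis unfolding K_def \<kappa>_def by (intro nat_mono ceiling_mono)
        qed
      qed (use elim in auto)
      finally show ?case .
    qed
  qed
  have "(\<lambda>n. \<Sum>j<N. bound n j) \<longlonglongrightarrow> (\<Sum>j<N. 0)" by (intro tendsto_sum bound)
  then have "(\<lambda>n. \<Sum>j<N. bound n j) \<longlonglongrightarrow> 0" by simp
  with le show ?thesis
    by (rule measure_tendsto_0)
qed

theorem MaxLoad_threshold_le_asymp:
  fixes \<rho> :: real and M :: "nat \<Rightarrow> 'a measure" and Z0 Z1 :: "nat \<Rightarrow> nat \<Rightarrow> 'a \<Rightarrow> nat"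
  assumes \<rho>: "\<rho> > 0" and src: "\<And>n. n \<ge> 3 \<Longrightarrow> two_thinning_source (M n) n (Z0 n) (Z1 n)"
    and d: "d > 0"
  shows "(\<lambda>n. measure (M n) {\<omega> \<in> space (M n).
    (2 + d) * threshold n < MaxLoad n (threshold_strategy (threshold n)) (Z0 n) (Z1 n) (\<rho> * real n) \<omega>})
    \<longlonglongrightarrow> 0"
proof -
  define \<delta> where "\<delta> = d / 2"
  \<comment> \<open>With about \<open>n * exp (- (1 - e) * rate n)\<close> rejected balls, the expected number of bins with
    \<open>(1 + \<delta>) * threshold n\<close> secondary balls is of order \<open>n\<close> to the power \<open>1 - (1 + \<delta>) * (1 - e)\<close>, up to
    lower order terms in the exponent; this \<open>e\<close> makes the power \<open>- \<delta> / 2\<close>.\<close>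
  define e where "e = \<delta> / (2 * (1 + \<delta>))"
  have \<delta>: "\<delta> > 0" "d = 2 * \<delta>" using d by (auto simp: \<delta>_def)
  have e: "e > 0" "(1 + \<delta>) * (1 - e) = 1 + \<delta> / 2" using \<delta> by (auto simp: e_def field_simps)
  have e1: "e < 1" using \<delta> by (simp add: e_def field_simps)
  \<comment> \<open>the largest integer below the threshold\<close>
  define k where "k n = nat \<lceil>threshold n\<rceil> - 1" for n
  define v where "v n = nat \<lceil>real n * exp (- (1 - e) * rate n)\<rceil>" for n
  define s where "s n = nat \<lceil>(1 + \<delta>) * threshold n\<rceil>" for n
  define T where "T n = nat \<lfloor>\<rho> * real n\<rfloor>" for n
  define B where "B n = \<rho> * exp (- (e / 2 * rate n)) + exp (- (\<delta> / 2 * ln (real n) - (1 + \<delta>) * rate n))" for n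
  have "(\<lambda>n. exp (- (e / 2 * rate n))) \<longlonglongrightarrow> 0"
  proof -
    have "filterlim (\<lambda>n. e / 2 * rate n) at_top sequentially"
      by (rule filterlim_tendsto_pos_mult_at_top[OF tendsto_const _ rate_at_top]) (use e in simp)
    then show ?thesis
      by (intro filterlim_compose[OF exp_at_bot]) (simp only: filterlim_uminus_at_top[symmetric])
  qed
  moreover have "(\<lambda>n. exp (- (\<delta> / 2 * ln (real n) - (1 + \<delta>) * rate n))) \<longlonglongrightarrow> 0"
    by (intro filterlim_compose[OF exp_at_bot] filterlim_uminus_at_top[THEN iffD1] ln_minus_rate_at_top)
      (use \<delta>(1) in simp)
  ultimately have "B \<longlonglongrightarrow> \<rho> * 0 + 0"
    unfolding B_def by (intro tendsto_intros)
  then have B: "B \<longlonglongrightarrow> 0" by simp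
  have "\<forall>\<^sub>F n in sequentially. measure (M n) {\<omega> \<in> space (M n).
    (2 + d) * threshold n < MaxLoad n (threshold_strategy (threshold n)) (Z0 n) (Z1 n) (\<rho> * real n) \<omega>} \<le> B n"
  proof -
    have "\<forall>\<^sub>F n in sequentially. \<forall>k::nat. threshold n - 1 \<le> real k \<longrightarrow>
        (\<rho> * exp 1 / real k) ^ k \<le> exp (- (1 - e / 2) * rate n)"
      using \<rho> e by (intro power_le_exp_rate) auto
    moreover have "\<forall>\<^sub>F n in sequentially. 1 * ln (real n) - (1 - e) * rate n \<ge> 0"
      using ln_minus_rate_at_top[of 1 "1 - e"] by (simp only: filterlim_at_top zero_less_one simp_thms)
    moreover have "\<forall>\<^sub>F n in sequentially. rate n \<ge> ln 2 / (1 - e)"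
      using rate_at_top by (simp only: filterlim_at_top)
    moreover have "\<forall>\<^sub>F n in sequentially. threshold n \<ge> 1 / \<delta>"
      using threshold_at_top by (simp only: filterlim_at_top)
    moreover have "\<forall>\<^sub>F n::nat in sequentially. n \<ge> 3" by (rule eventually_ge_at_top)
    ultimately show ?thesis using threshold_pos threshold_le_rate threshold_times_rate
    proof eventually_elim
      case (elim n)
      interpret two_thinning_source "M n" n "Z0 n" "Z1 n" using elim by (intro src) simp
      let ?l = "threshold n" and ?f = "threshold_strategy (threshold n)"
      have n: "real n > 0" "real n = exp (ln (real n))" using elim by auto
      have k: "real (k n) < ?l" "?l - 1 \<le> real (k n)"
        using elim(6) unfolding k_def by linarith+
      have v_ge: "real n * exp (- (1 - e) * rate n) \<le> real (v n)"
        unfolding v_def by (intro of_nat_nat_ceiling_bounds(1)) simp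
      have v_le: "real (v n) \<le> real n * (2 * exp (- (1 - e) * rate n))"
      proof -
        have "1 \<le> exp (ln (real n) - (1 - e) * rate n)" using elim by simp
        also have "\<dots> = exp (ln (real n)) * exp (- (1 - e) * rate n)"
          unfolding exp_add[symmetric] by (simp add: algebra_simps)
        also have "\<dots> = real n * exp (- (1 - e) * rate n)" using n(1) by simp
        finally have "1 \<le> real n * exp (- (1 - e) * rate n)" .
        moreover have "real (v n) \<le> real n * exp (- (1 - e) * rate n) + 1"
          unfolding v_def by (rule of_nat_nat_ceiling_bounds(2)) simp
        ultimately show ?thesis by linarith
      qed
      have v0: "v n > 0"
      proof -
        have "0 < real n * exp (- (1 - e) * rate n)" using n by simp
        then have "0 < real (v n)" using v_ge by linarith
        then show ?thesis by simp
      qed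
      have T: "real (T n) \<le> \<rho> * real n" using \<rho> unfolding T_def by simp
      have choose: "real (m choose i) * fact i \<le> real m ^ i" for m i
        by (metis binomial_fact_pow of_nat_fact of_nat_le_iff of_nat_mult of_nat_power)
      have first: "real (T n) * (real (T n choose k n) / real n ^ k n) / real (v n) \<le> \<rho> * exp (- (e / 2 * rate n))"
      proof -
        have "real (T n choose k n) / real n ^ k n \<le> (real (T n) ^ k n / fact (k n)) / real n ^ k n"
          using choose[of "T n" "k n"] by (intro divide_right_mono) (auto simp: field_simps)
        also have "\<dots> \<le> ((\<rho> * real n) ^ k n / fact (k n)) / real n ^ k n"
          using T by (intro divide_right_mono power_mono) auto
        also have "\<dots> = \<rho> ^ k n / fact (k n)" using n(1) by (simp add: power_mult_distrib)
        also have "\<dots> \<le> \<rho> ^ k n / (real (k n) / exp 1) ^ k n"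
          using \<rho> by (intro divide_left_mono fact_ge_power_div_exp mult_pos_pos) (auto simp: zero_less_power_eq)
        also have "\<dots> = (\<rho> * exp 1 / real (k n)) ^ k n" by (simp add: power_divide power_mult_distrib)
        also have "\<dots> \<le> exp (- (1 - e / 2) * rate n)" using elim(1) k(2) by blast
        finally have "real (T n) * (real (T n choose k n) / real n ^ k n) / real (v n)
            \<le> (\<rho> * real n) * exp (- (1 - e / 2) * rate n) / (real n * exp (- (1 - e) * rate n))"
          using T v_ge v0 n \<rho> by (intro frac_le mult_mono mult_nonneg_nonneg) auto
        also have "\<dots> = \<rho> * (exp (- (1 - e / 2) * rate n) / exp (- (1 - e) * rate n))" using n(1) by simp
        also have "exp (- (1 - e / 2) * rate n) / exp (- (1 - e) * rate n) = exp (- (e / 2 * rate n))"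
          unfolding exp_diff[symmetric] by (rule arg_cong[where f = exp]) (simp add: algebra_simps)
        finally show ?thesis .
      qed
      have second: "real n * (real (v n choose s n) / real n ^ s n)
          \<le> exp (- (\<delta> / 2 * ln (real n) - (1 + \<delta>) * rate n))"
      proof -
        let ?c = "(1 - e) * rate n - ln 2"
        have c: "?c \<ge> 0" using elim(3) e1 by (simp add: field_simps)
        have "real (v n choose s n) \<le> real (v n choose s n) * fact (s n)"
          using mult_left_mono[OF fact_ge_1[of "s n", where 'a = real], of "real (v n choose s n)"] by simp
        also have "\<dots> \<le> real (v n) ^ s n" by (rule choose)
        finally have "real (v n choose s n) / real n ^ s n \<le> (real (v n) / real n) ^ s n"
          by (simp add: power_divide divide_right_mono)
        also have "\<dots> \<le> (2 * exp (- (1 - e) * rate n)) ^ s n"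
          using v_le n(1) by (intro power_mono) (simp_all add: field_simps)
        also have "2 * exp (- (1 - e) * rate n) = exp (- ?c)"
        proof -
          have "exp (- ?c) = exp (ln 2) * exp (- (1 - e) * rate n)"
            unfolding exp_add[symmetric] by (rule arg_cong[where f = exp]) (simp add: algebra_simps)
          then show ?thesis by simp
        qed
        also have "exp (- ?c) ^ s n = exp (- (real (s n) * ?c))"
          unfolding exp_of_nat_mult[symmetric] by (rule arg_cong[where f = exp]) (simp add: algebra_simps)
        also have "\<dots> \<le> exp (- ((1 + \<delta>) * ?l * ?c))"
        proof -
          have "(1 + \<delta>) * ?l \<le> real (s n)" unfolding s_def by linarith
          then have "(1 + \<delta>) * ?l * ?c \<le> real (s n) * ?c" using c by (rule mult_right_mono)
          then show ?thesis by simp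
        qed
        also have "(1 + \<delta>) * ?l * ?c = ((1 + \<delta>) * (1 - e)) * (?l * rate n) - (1 + \<delta>) * (ln 2 * ?l)"
          by (simp add: algebra_simps)
        also have "\<dots> = (1 + \<delta> / 2) * ln (real n) - (1 + \<delta>) * (ln 2 * ?l)"
          using e(2) elim(8) by simp
        finally have "real n * (real (v n choose s n) / real n ^ s n)
            \<le> real n * exp (- ((1 + \<delta> / 2) * ln (real n) - (1 + \<delta>) * (ln 2 * ?l)))"
          using n by (intro mult_left_mono) auto
        also have "\<dots> = exp (ln (real n)) * exp (- ((1 + \<delta> / 2) * ln (real n) - (1 + \<delta>) * (ln 2 * ?l)))"
          using n(2) by simp
        also have "\<dots> = exp (- (\<delta> / 2 * ln (real n) - (1 + \<delta>) * (ln 2 * ?l)))"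
          unfolding exp_add[symmetric] by (rule arg_cong[where f = exp]) (simp add: algebra_simps)
        also have "\<dots> \<le> exp (- (\<delta> / 2 * ln (real n) - (1 + \<delta>) * rate n))"
        proof -
          have "ln 2 * ?l \<le> 1 * ?l" using elim ln_le_minus_one[of "2::real"] by (intro mult_right_mono) auto
          then have "ln 2 * ?l \<le> rate n" using elim(7) by simp
          then have "(1 + \<delta>) * (ln 2 * ?l) \<le> (1 + \<delta>) * rate n"
            using \<delta>(1) by (intro mult_left_mono) auto
          then show ?thesis by simp
        qed
        finally show ?thesis .
      qed
      have "?l + real (s n) \<le> (2 + d) * ?l"
      proof -
        have "1 \<le> \<delta> * ?l" using elim(4) \<delta> by (simp add: field_simps)
        moreover have "real (s n) \<le> (1 + \<delta>) * ?l + 1"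
          unfolding s_def using elim \<delta> by (intro of_nat_nat_ceiling_bounds(2)) auto
        ultimately show ?thesis by (simp add: \<delta>(2) algebra_simps)
      qed
      then have "prob {\<omega> \<in> space (M n). (2 + d) * ?l < MaxLoad n ?f (Z0 n) (Z1 n) (\<rho> * real n) \<omega>}
          \<le> prob {\<omega> \<in> space (M n). ?l + real (s n) \<le> MaxLoad n ?f (Z0 n) (Z1 n) (\<rho> * real n) \<omega>}"
        by (intro finite_measure_mono MaxLoad_event_measurable) auto
      also have "\<dots> \<le> real (T n) * (real (T n choose k n) / real n ^ k n) / real (v n)
          + real n * (real (v n choose s n) / real n ^ s n)"
        by (rule prob_MaxLoad_threshold_ge_le[OF k(1) v0 T_def])
      also have "\<dots> \<le> B n" unfolding B_def using first second by (rule add_mono)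
      finally show ?case .
    qed
  qed
  then show ?thesis using B by (rule measure_tendsto_0)
qed

lemma (in prob_space) prob_ge_one_minus_two:
  assumes "A \<in> events" "B \<in> events" "G \<in> events" "space M - A - B \<subseteq> G"
  shows "1 - prob A - prob B \<le> prob G"
proof -
  have "1 = prob (space M)" by (simp add: prob_space)
  also have "\<dots> \<le> prob (G \<union> (A \<union> B))" using assms by (intro finite_measure_mono) auto
  also have "\<dots> \<le> prob G + prob (A \<union> B)" using assms by (intro measure_Un_le) auto
  also have "prob (A \<union> B) \<le> prob A + prob B" using assms by (intro measure_Un_le) auto
  finally show ?thesis by linarith
qed

theorem theorem1:
  fixes \<rho> :: real
    and M :: "nat \<Rightarrow> 'a measure"
    and Z0 Z1 :: "nat \<Rightarrow> nat \<Rightarrow> 'a \<Rightarrow> nat"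
    and f :: "nat \<Rightarrow> strategy"
  assumes "\<rho> > 0"
    and "\<And>n. n \<ge> 3 \<Longrightarrow> two_thinning_source (M n) n (Z0 n) (Z1 n)"
    and "\<And>n. n \<ge> 3 \<Longrightarrow> f n = threshold_strategy (sqrt (2 * ln (real n) / ln (ln (real n))))"
  shows "asymptotically_optimal M Z0 Z1 \<rho> f \<and>
    (\<forall>\<delta>>0. (\<lambda>n. measure (M n) {\<omega> \<in> space (M n).
        (1 - \<delta>) * sqrt (8 * ln (real n) / ln (ln (real n)))
            \<le> MaxLoad n (f n) (Z0 n) (Z1 n) (\<rho> * real n) \<omega> \<and>
        MaxLoad n (f n) (Z0 n) (Z1 n) (\<rho> * real n) \<omega>
            \<le> (1 + \<delta>) * sqrt (8 * ln (real n) / ln (ln (real n)))}) \<longlonglongrightarrow> 1)"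
proof -
  let ?L = "\<lambda>g n. MaxLoad n (g n) (Z0 n) (Z1 n) (\<rho> * real n)"
  let ?P = "\<lambda>n Q. measure (M n) {\<omega> \<in> space (M n). Q \<omega>}"
  have upper: "(\<lambda>n. ?P n (\<lambda>\<omega>. (2 + d) * threshold n < ?L f n \<omega>)) \<longlonglongrightarrow> 0" if "d > 0" for d
  proof (rule Lim_transform_eventually[OF MaxLoad_threshold_le_asymp[OF assms(1,2) that]])
    show "\<forall>\<^sub>F n in sequentially. ?P n (\<lambda>\<omega>. (2 + d) * threshold n <
        MaxLoad n (threshold_strategy (threshold n)) (Z0 n) (Z1 n) (\<rho> * real n) \<omega>) =
      ?P n (\<lambda>\<omega>. (2 + d) * threshold n < ?L f n \<omega>)"
      using eventually_ge_at_top[of 3] by eventually_elim (simp add: assms(3) threshold_def)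
  qed
  have whp: "(\<lambda>n. ?P n (Q n)) \<longlonglongrightarrow> 1"
    if d: "d > 0"
      and meas: "\<And>n. n \<ge> 3 \<Longrightarrow> {\<omega> \<in> space (M n). Q n \<omega>} \<in> sets (M n)"
      and Q: "\<And>n \<omega>. n \<ge> 3 \<Longrightarrow> threshold n > 0 \<Longrightarrow> ?L f n \<omega> \<le> (2 + d) * threshold n \<Longrightarrow>
          (2 - d) * threshold n \<le> ?L g n \<omega> \<Longrightarrow> Q n \<omega>"
    for d :: real and g :: "nat \<Rightarrow> strategy" and Q :: "nat \<Rightarrow> 'a \<Rightarrow> bool"
  proof -
    let ?U = "\<lambda>n \<omega>. (2 + d) * threshold n < ?L f n \<omega>" and ?D = "\<lambda>n \<omega>. ?L g n \<omega> < (2 - d) * threshold n"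
    have "(\<lambda>n. 1 - ?P n (?U n) - ?P n (?D n)) \<longlonglongrightarrow> 1 - 0 - 0"
      by (intro tendsto_diff tendsto_const upper[OF d] MaxLoad_ge_asymp[OF assms(1,2) d])
    then have lim: "(\<lambda>n. 1 - ?P n (?U n) - ?P n (?D n)) \<longlonglongrightarrow> 1" by simp
    have n3: "\<forall>\<^sub>F n::nat in sequentially. n \<ge> 3" by (rule eventually_ge_at_top)
    have le1: "\<forall>\<^sub>F n in sequentially. ?P n (Q n) \<le> 1"
      using n3
    proof eventually_elim
      case (elim n)
      interpret two_thinning_source "M n" n "Z0 n" "Z1 n" using elim by (rule assms(2))
      show ?case by (rule prob_le_1)
    qed
    have ge: "\<forall>\<^sub>F n in sequentially. 1 - ?P n (?U n) - ?P n (?D n) \<le> ?P n (Q n)"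
      using n3 threshold_pos
    proof eventually_elim
      case (elim n)
      interpret two_thinning_source "M n" n "Z0 n" "Z1 n" using elim(1) by (rule assms(2))
      show ?case
      proof (rule prob_ge_one_minus_two)
        show "space (M n) - {\<omega> \<in> space (M n). ?U n \<omega>} - {\<omega> \<in> space (M n). ?D n \<omega>}
            \<subseteq> {\<omega> \<in> space (M n). Q n \<omega>}"
          using Q[OF elim] by (auto simp: not_less)
      qed (use meas elim in \<open>auto intro: MaxLoad_event_measurable\<close>)
    qed
    show ?thesis by (rule tendsto_sandwich[OF ge le1 lim tendsto_const])
  qed
  have "asymptotically_optimal M Z0 Z1 \<rho> f"
    unfolding asymptotically_optimal_def
  proof (intro allI impI)
    fix g :: "nat \<Rightarrow> strategy" and \<delta> :: real
    assume \<delta>: "\<delta> > 0"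
    define d where "d = 2 * \<delta> / (2 + \<delta>)"
    have d: "d > 0" "2 + d = (1 + \<delta>) * (2 - d)" using \<delta> by (auto simp: d_def field_simps)
    show "(\<lambda>n. ?P n (\<lambda>\<omega>. ?L f n \<omega> \<le> (1 + \<delta>) * ?L g n \<omega>)) \<longlonglongrightarrow> 1"
    proof (rule whp[where d = d and g = g and Q = "\<lambda>n \<omega>. ?L f n \<omega> \<le> (1 + \<delta>) * ?L g n \<omega>"])
      show "d > 0" by (rule d(1))
    next
      fix n :: nat
      assume n: "n \<ge> 3"
      interpret two_thinning_source "M n" n "Z0 n" "Z1 n" using n by (rule assms(2))
      show "{\<omega> \<in> space (M n). ?L f n \<omega> \<le> (1 + \<delta>) * ?L g n \<omega>} \<in> sets (M n)"
        by (measurable) (auto intro: MaxLoad_measurable)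
    next
      fix n \<omega>
      assume f: "?L f n \<omega> \<le> (2 + d) * threshold n" and g: "(2 - d) * threshold n \<le> ?L g n \<omega>"
      note f
      also have "(2 + d) * threshold n = (1 + \<delta>) * ((2 - d) * threshold n)" by (simp add: d(2))
      also have "\<dots> \<le> (1 + \<delta>) * ?L g n \<omega>" using g \<delta> by (intro mult_left_mono) auto
      finally show "?L f n \<omega> \<le> (1 + \<delta>) * ?L g n \<omega>" .
    qed
  qed
  moreover have "(\<lambda>n. ?P n (\<lambda>\<omega>. (1 - \<delta>) * sqrt (8 * ln (real n) / ln (ln (real n))) \<le> ?L f n \<omega> \<and>
      ?L f n \<omega> \<le> (1 + \<delta>) * sqrt (8 * ln (real n) / ln (ln (real n))))) \<longlonglongrightarrow> 1" if \<delta>: "\<delta> > 0" for \<delta> :: real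
  proof -
    have sqrt8: "sqrt (8 * ln (real n) / ln (ln (real n))) = 2 * threshold n" for n
    proof -
      have "8 * ln (real n) / ln (ln (real n)) = 4 * (2 * ln (real n) / ln (ln (real n)))" by simp
      then show ?thesis by (simp only: threshold_def real_sqrt_mult real_sqrt_four)
    qed
    show ?thesis
      unfolding sqrt8
    proof (rule whp[where d = "2 * \<delta>" and g = f and
          Q = "\<lambda>n \<omega>. (1 - \<delta>) * (2 * threshold n) \<le> ?L f n \<omega> \<and> ?L f n \<omega> \<le> (1 + \<delta>) * (2 * threshold n)"])
      fix n :: nat
      assume "n \<ge> 3"
      then interpret two_thinning_source "M n" n "Z0 n" "Z1 n" by (rule assms(2))
      show "{\<omega> \<in> space (M n). (1 - \<delta>) * (2 * threshold n) \<le> ?L f n \<omega> \<and>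
          ?L f n \<omega> \<le> (1 + \<delta>) * (2 * threshold n)} \<in> sets (M n)"
        by (rule MaxLoad_event_measurable)
    qed (use \<delta> in \<open>auto simp: algebra_simps\<close>)
  qed
  ultimately show ?thesis by blast
qed

end
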